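(* Let $p>0$ and $q>0$ be constants. Suppose that the following four conditions hold, with all constants independent of the step size $\Delta$ and of the initial data. (i) For each step size $\Delta$ there is a continuous numerical solution $\{X(t;0,\xi)\}_{t\ge-\tau}$ approximating the solution of the SDDE, and its segment process $\{X_{t_k}^{0,\xi}\}_{k\in\mathbb N}$ is a time-homogeneous Markov process. (ii) There are positive constants $K_1,K_2,K_3$ such that for all $t\ge0$ and all initial data $\xi$, $\mathbb E\|x_t^{0,\xi}\|^p\le K_1\mathbb E\|\xi\|^pe^{-K_2t}+K_3$. (iii) There are positive constants $K_4,K_5$ such that for every compact subset $K\subset C$, all $K$-valued initial data $\xi,\eta$ and all $t\ge0$, $\mathbb E\big(\|x_t^{0,\xi}-x_t^{0,\eta}\|^p\big)\le K_4\,\mathbb E\big(\|\xi-\eta\|^p\big)e^{-K_5t}$. (iv) For all grid times $0\le T_1<T_2$ there is a constant $C_{T_2-T_1}$, depending on $T_1,T_2$ only through $T_2-T_1$, such that $$\sup_{T_1\le t_k\le T_2}\mathbb E\Big(\big\|x_{t_k}^{T_1,X_{T_1}^{0,\xi}}-X_{t_k}^{T_1,X_{T_1}^{0,\xi}}\big\|^p\Big)\le C_{T_2-T_1}\Big(1+\sup_{T_1-\tau\le t_k\le T_1}\mathbb E\|X_{t_k}^{0,\xi}\|^p\Big)\Delta^q,$$ where by convention $\sup_{-\tau\le t_k\le0}\mathbb E\|X_{t_k}^{0,\xi}\|^p:=\mathbb E\|\xi\|^p$ (terms with $t_k\le 0$ are read as $\mathbb E\|\xi\|^p$). Then for every bounded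 $\mathcal F_0$-measurable $C$-valued $\xi$ the numerical segment process converges strongly to the true segment process in the infinite horizon: there are $\Delta^*>0$ and a positive constant $\mathcal K$, independent of $k$ and $\Delta$, such that for all step sizes $\Delta\in(0,\Delta^* )$ $$\sup_{k\in\mathbb N}\mathbb E\big(\|x_{t_k}^{0,\xi}-X_{t_k}^{0,\xi}\|^p\big)\le \mathcal K\,\Delta^q .$$
   Context: Let $\tau>0$, $d,m\in\mathbb N_+$; $|\cdot|$ is the Euclidean norm on $\mathbb R^d$ (trace norm on $\mathbb R^{d\times m}$); $C=C([-\tau,0];\mathbb R^d)$ is the space of continuous functions with norm $\|X\|=\sup_{-\tau\le\theta\le0}|X(\theta)|$. $W$ is an $m$-dimensional Brownian motion on a probability space with right-continuous complete filtration $\{\mathcal F_t\}_{t\ge0}$. The stochastic delay differential equation (SDDE) is $$dx(t)=f(x(t),x(t-\tau))\,dt+g(x(t),x(t-\tau))\,dW(t),\quad t>0,\qquad x(\theta)=\xi(\theta),\ \theta\in[-\tau,0],$$ with $f:\mathbb R^d\times\mathbb R^d\to\mathbb R^d$ and $g:\mathbb R^d\times\mathbb R^d\to\mathbb R^{d\times m}$ Borel measurable; it is assumed to have a unique global solution. For $s\ge0$ and an $\mathcal F_s$-measurable $C$-valued random variable $\eta$, $x(t;s,\eta)$, $t\ge s-\tau$, is the solution started at time $s$ from $\eta$, i.e. $x(s+\theta;s,\eta)=\eta(\theta)$ for $\theta\in[-\tau,0]$, and $x_t^{s,\eta}(\theta)=x(t+\theta;s,\eta)$ is its segment process. The segment process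 is a homogeneous Markov process. Initial data are random, $C$-valued, and measurable with respect to the $\sigma$-algebra at the starting time; since the equation is autonomous, a solution started at time $s$ from an $\mathcal F_s$-measurable segment $\eta$ is regarded as a solution $x(\cdot;0,\eta)$ started at time $0$ (with shifted Brownian motion and filtration), and hypotheses on solutions started at time $0$ apply to such initial data. Step sizes are $\Delta=\tau/M$ with $M\in\mathbb N_+$; $t_k=k\Delta$ for $k\ge-M$; a grid time is an integer multiple of $\Delta$. A continuous numerical solution (for step size $\Delta$) is a continuous-in-time process $X(t;s,\eta)$, $t\ge s-\tau$, defined for starting grid times $s\ge0$ and $\mathcal F_s$-measurable $C$-valued $\eta$, with $X(s+\theta;s,\eta)=\eta(\theta)$ for $\theta\in[-\tau,0]$. Its segment is $X_t^{s,\eta}(\theta)=X(t+\theta;s,\eta)$, $\theta\in[-\tau,0]$. It has the flow property $X(t;0,\xi)=X(t;s,X_s^{0,\xi})$ for $0\le s<t$ with $s$ a grid time; segments at grid times $s$ are $\mathcal F_s$-measurable. *)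

theory Defs
  imports "HOL-Probability.Probability"
begin

section \<open>The space \<open>C([-\<tau>, 0]; \<real>\<^sup>d)\<close>\<close>

text \<open>Elements are functions on all of \<^typ>\<open>real\<close>, continuous on \<open>[-\<tau>, 0]\<close> and
  \<^const>\<open>undefined\<close> elsewhere; the metric is the supremum metric.\<close>

definition Cspace :: "real \<Rightarrow> (real \<Rightarrow> real ^ 'd) metric" where
  "Cspace \<tau> = cfunspace (top_of_set {-\<tau>..0}) euclidean_metric"

definition Cnorm :: "real \<Rightarrow> (real \<Rightarrow> real ^ 'd) \<Rightarrow> real" where
  "Cnorm \<tau> \<phi> = (SUP \<theta>\<in>{-\<tau>..0}. norm (\<phi> \<theta>))"

definition Cborel :: "real \<Rightarrow> (real \<Rightarrow> real ^ 'd) measure" where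
  "Cborel \<tau> = sigma (mspace (Cspace \<tau>)) {U. openin (mtopology_of (Cspace \<tau>)) U}"

lemma mspace_Cspace:
  "mspace (Cspace \<tau>) = {\<phi>. \<phi> \<in> extensional {-\<tau>..0} \<and> continuous_on {-\<tau>..0} \<phi>}"
proof -
  have "Metric_space.mbounded UNIV dist (\<phi> ` {-\<tau>..0})"
    if "continuous_on {-\<tau>..0} \<phi>" for \<phi> :: "real \<Rightarrow> real ^ 'd"
  proof -
    have "bounded (\<phi> ` {-\<tau>..0})"
      using that by (intro compact_imp_bounded compact_continuous_image) auto
    then show ?thesis by simp
  qed
  then show ?thesis
    by (auto simp: Cspace_def)
qed

lemma mdist_Cspace:
  assumes "0 \<le> \<tau>" "\<phi> \<in> mspace (Cspace \<tau>)" "\<psi> \<in> mspace (Cspace \<tau>)"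
  shows "mdist (Cspace \<tau>) \<phi> \<psi> = Cnorm \<tau> (\<lambda>\<theta>. \<phi> \<theta> - \<psi> \<theta>)"
proof -
  have "\<phi> \<in> Metric_space.fspace UNIV dist {-\<tau>..0}" "\<psi> \<in> Metric_space.fspace UNIV dist {-\<tau>..0}"
    using assms cfunspace_subset_funspace[of "top_of_set {-\<tau>..0}" "euclidean_metric :: (real ^ 'd) metric"]
    by (auto simp: Cspace_def simp del: mspace_cfunspace)
  with assms(1) show ?thesis
    by (simp add: Cspace_def mdist_cfunspace_eq_mdist_funspace Cnorm_def dist_norm
        Metric_space.fdist_def[OF Met_TC.Metric_space_axioms])
qed

text \<open>\<open>moment M \<tau> p Y\<close> is \<open>E \<parallel>Y\<parallel>\<^sup>p\<close>, possibly infinite.\<close>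

definition moment :: "'w measure \<Rightarrow> real \<Rightarrow> real \<Rightarrow> ('w \<Rightarrow> real \<Rightarrow> real ^ 'd) \<Rightarrow> ennreal" where
  "moment M \<tau> p Y = (\<integral>\<^sup>+ \<omega>. ennreal (Cnorm \<tau> (Y \<omega>) powr p) \<partial>M)"

definition segment :: "real \<Rightarrow> (real \<Rightarrow> 'w \<Rightarrow> real ^ 'd) \<Rightarrow> real \<Rightarrow> 'w \<Rightarrow> real \<Rightarrow> real ^ 'd" where
  "segment \<tau> x t \<omega> = (\<lambda>\<theta>\<in>{-\<tau>..0}. x (t + \<theta>) \<omega>)"


section \<open>Filtrations and Brownian motion\<close>

text \<open>Filtrations are indexed by \<^typ>\<open>real\<close>, but only indices \<open>t \<ge> 0\<close> matter.\<close>

definition usual_filtration :: "'w measure \<Rightarrow> (real \<Rightarrow> 'w measure) \<Rightarrow> bool" where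
  "usual_filtration M F \<longleftrightarrow>
     (\<forall>t\<ge>0. subalgebra M (F t)) \<and>
     (\<forall>s\<ge>0. \<forall>t\<ge>s. sets (F s) \<subseteq> sets (F t)) \<and>
     (\<forall>t\<ge>0. sets (F t) = (\<Inter>u\<in>{t<..}. sets (F u))) \<and>
     (\<forall>N\<in>null_sets M. \<forall>A\<subseteq>N. A \<in> sets (F 0))"

definition brownian_motion ::
  "'w measure \<Rightarrow> (real \<Rightarrow> 'w measure) \<Rightarrow> (real \<Rightarrow> 'w \<Rightarrow> real ^ 'm) \<Rightarrow> bool" where
  "brownian_motion M F W \<longleftrightarrow>
     (\<forall>t\<ge>0. W t \<in> borel_measurable (F t)) \<and>
     (AE \<omega> in M. W 0 \<omega> = 0) \<and>
     (AE \<omega> in M. continuous_on {0..} (\<lambda>t. W t \<omega>)) \<and>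
     (\<forall>s\<ge>0. \<forall>t>s.
        prob_space.indep_set M (sets (F s))
          (sets (vimage_algebra (space M) (\<lambda>\<omega>. W t \<omega> - W s \<omega>) borel)) \<and>
        prob_space.indep_vars M (\<lambda>_. borel) (\<lambda>i \<omega>. (W t \<omega> - W s \<omega>) $ i) UNIV \<and>
        (\<forall>i. distributed M lborel (\<lambda>\<omega>. (W t \<omega> - W s \<omega>) $ i)
               (\<lambda>z. ennreal (normal_density 0 (sqrt (t - s)) z))))"


section \<open>The stochastic integral\<close>

text \<open>Step processes are finite sums of elementary processes with value \<open>\<phi> i\<close> on \<open>(u i, v i]\<close> and \<open>0\<close>
  elsewhere, where \<open>\<phi> i\<close> is bounded and \<open>F (u i)\<close>-measurable; the intervals may overlap. On
  \<^typ>\<open>real ^ 'm ^ 'd\<close> the function \<^const>\<open>norm\<close> is the trace (Frobenius) norm.\<close>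

definition step_process ::
  "'w measure \<Rightarrow> (real \<Rightarrow> 'w measure) \<Rightarrow> real \<Rightarrow> nat \<Rightarrow> (nat \<Rightarrow> real) \<Rightarrow> (nat \<Rightarrow> real) \<Rightarrow>
   (nat \<Rightarrow> 'w \<Rightarrow> real ^ 'm ^ 'd) \<Rightarrow> bool" where
  "step_process M F s n u v \<phi> \<longleftrightarrow>
     (\<forall>i<n. s \<le> u i \<and> u i \<le> v i \<and> \<phi> i \<in> borel_measurable (F (u i)) \<and>
            (\<exists>B. \<forall>\<omega>\<in>space M. norm (\<phi> i \<omega>) \<le> B))"

definition step_value ::
  "nat \<Rightarrow> (nat \<Rightarrow> real) \<Rightarrow> (nat \<Rightarrow> real) \<Rightarrow> (nat \<Rightarrow> 'w \<Rightarrow> real ^ 'm ^ 'd) \<Rightarrow>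
   real \<Rightarrow> 'w \<Rightarrow> real ^ 'm ^ 'd" where
  "step_value n u v \<phi> r \<omega> = (\<Sum>i<n. indicator {u i<..v i} r *\<^sub>R \<phi> i \<omega>)"

definition step_integral ::
  "(real \<Rightarrow> 'w \<Rightarrow> real ^ 'm) \<Rightarrow> nat \<Rightarrow> (nat \<Rightarrow> real) \<Rightarrow> (nat \<Rightarrow> real) \<Rightarrow>
   (nat \<Rightarrow> 'w \<Rightarrow> real ^ 'm ^ 'd) \<Rightarrow> real \<Rightarrow> 'w \<Rightarrow> real ^ 'd" where
  "step_integral W n u v \<phi> r \<omega> = (\<Sum>i<n. \<phi> i \<omega> *v (W (min r (v i)) \<omega> - W (min r (u i)) \<omega>))"

text \<open>Convergence to zero in probability of nonnegative quantities. For measurable \<open>Z\<close> the outer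
  measure is just the probability; it is used so that the notion cannot hold
  merely because some set fails to be measurable.\<close>

definition null_in_prob :: "'w measure \<Rightarrow> (nat \<Rightarrow> 'w \<Rightarrow> ennreal) \<Rightarrow> bool" where
  "null_in_prob M Z \<longleftrightarrow>
     (\<forall>\<epsilon>>0. (\<lambda>j. outer_measure_of M {\<omega> \<in> space M. \<epsilon> < Z j \<omega>}) \<longlonglongrightarrow> 0)"

text \<open>\<open>ito_integral M F W s G I\<close>: the continuous adapted process \<open>(I t)\<close>, \<open>t \<ge> s\<close>, is (a version of)
  the Ito integral of \<open>G\<close> over \<open>[s, t]\<close> with respect to \<open>W\<close>, where \<open>G\<close> is measurable, adapted and
  almost surely locally square integrable.\<close>

definition ito_integral ::
  "'w measure \<Rightarrow> (real \<Rightarrow> 'w measure) \<Rightarrow> (real \<Rightarrow> 'w \<Rightarrow> real ^ 'm) \<Rightarrow> real \<Rightarrow>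
   (real \<Rightarrow> 'w \<Rightarrow> real ^ 'm ^ 'd) \<Rightarrow> (real \<Rightarrow> 'w \<Rightarrow> real ^ 'd) \<Rightarrow> bool" where
  "ito_integral M F W s G I \<longleftrightarrow>
     (\<lambda>(r, \<omega>). G r \<omega>) \<in> borel_measurable (restrict_space borel {s..} \<Otimes>\<^sub>M M) \<and>
     (\<forall>r\<ge>s. G r \<in> borel_measurable (F r)) \<and>
     (AE \<omega> in M. \<forall>T\<ge>s. (\<integral>\<^sup>+ r\<in>{s..T}. ennreal ((norm (G r \<omega>))\<^sup>2) \<partial>lborel) < \<infinity>) \<and>
     (\<forall>r\<ge>s. I r \<in> borel_measurable (F r)) \<and>
     (\<forall>\<omega>\<in>space M. continuous_on {s..} (\<lambda>r. I r \<omega>)) \<and>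
     (\<exists>n u v \<phi>.
        (\<forall>j. step_process M F s (n j) (u j) (v j) (\<phi> j)) \<and>
        (\<forall>T\<ge>s.
           null_in_prob M (\<lambda>j \<omega>. \<integral>\<^sup>+ r\<in>{s..T}.
             ennreal ((norm (step_value (n j) (u j) (v j) (\<phi> j) r \<omega> - G r \<omega>))\<^sup>2) \<partial>lborel) \<and>
           null_in_prob M (\<lambda>j \<omega>. SUP r\<in>{s..T}.
             ennreal (norm (step_integral W (n j) (u j) (v j) (\<phi> j) r \<omega> - I r \<omega>)))))"


section \<open>The stochastic delay differential equation\<close>

text \<open>\<open>y\<close> solves the equation on \<open>[s, \<infinity>)\<close> with initial segment \<open>\<eta>\<close> at time \<open>s\<close>. Paths are continuous
  for every \<open>\<omega>\<close> (not just almost surely), so that segments are genuinely \<open>C\<close>-valued.\<close>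

definition sdde_solution ::
  "'w measure \<Rightarrow> (real \<Rightarrow> 'w measure) \<Rightarrow> (real \<Rightarrow> 'w \<Rightarrow> real ^ 'm) \<Rightarrow> real \<Rightarrow>
   ((real ^ 'd) \<times> (real ^ 'd) \<Rightarrow> real ^ 'd) \<Rightarrow> ((real ^ 'd) \<times> (real ^ 'd) \<Rightarrow> real ^ 'm ^ 'd) \<Rightarrow>
   real \<Rightarrow> ('w \<Rightarrow> real \<Rightarrow> real ^ 'd) \<Rightarrow> (real \<Rightarrow> 'w \<Rightarrow> real ^ 'd) \<Rightarrow> bool" where
  "sdde_solution M F W \<tau> f g s \<eta> y \<longleftrightarrow>
     (\<forall>\<omega>\<in>space M. continuous_on {s - \<tau>..} (\<lambda>t. y t \<omega>)) \<and>
     (\<forall>t\<ge>s. y t \<in> borel_measurable (F t)) \<and>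
     (\<forall>\<omega>\<in>space M. \<forall>\<theta>\<in>{-\<tau>..0}. y (s + \<theta>) \<omega> = \<eta> \<omega> \<theta>) \<and>
     (AE \<omega> in M. \<forall>t\<ge>s. set_integrable lborel {s..t} (\<lambda>r. f (y r \<omega>, y (r - \<tau>) \<omega>))) \<and>
     (\<exists>I. ito_integral M F W s (\<lambda>r \<omega>. g (y r \<omega>, y (r - \<tau>) \<omega>)) I \<and>
          (AE \<omega> in M. \<forall>t\<ge>s.
             y t \<omega> = \<eta> \<omega> 0 + (LINT r:{s..t}|lborel. f (y r \<omega>, y (r - \<tau>) \<omega>)) + I t \<omega>))"

text \<open>\<open>x s \<eta> t\<close> is \<open>x(t; s, \<eta>)\<close>: the equation has a unique global solution for every starting time
  and every \<open>F s\<close>-measurable initial segment, and \<open>x\<close> is this solution.\<close>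

definition sdde_unique_solution ::
  "'w measure \<Rightarrow> (real \<Rightarrow> 'w measure) \<Rightarrow> (real \<Rightarrow> 'w \<Rightarrow> real ^ 'm) \<Rightarrow> real \<Rightarrow>
   ((real ^ 'd) \<times> (real ^ 'd) \<Rightarrow> real ^ 'd) \<Rightarrow> ((real ^ 'd) \<times> (real ^ 'd) \<Rightarrow> real ^ 'm ^ 'd) \<Rightarrow>
   (real \<Rightarrow> ('w \<Rightarrow> real \<Rightarrow> real ^ 'd) \<Rightarrow> real \<Rightarrow> 'w \<Rightarrow> real ^ 'd) \<Rightarrow> bool" where
  "sdde_unique_solution M F W \<tau> f g x \<longleftrightarrow>
     (\<forall>s\<ge>0. \<forall>\<eta> \<in> F s \<rightarrow>\<^sub>M Cborel \<tau>.
        sdde_solution M F W \<tau> f g s \<eta> (x s \<eta>) \<and>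
        (\<forall>y. sdde_solution M F W \<tau> f g s \<eta> y \<longrightarrow>
           (AE \<omega> in M. \<forall>t\<ge>s. y t \<omega> = x s \<eta> t \<omega>)))"


section \<open>Numerical solutions\<close>

definition step_sizes :: "real \<Rightarrow> real set" where
  "step_sizes \<tau> = {\<tau> / real m | m::nat. 0 < m}"

definition grid_times :: "real \<Rightarrow> real set" where
  "grid_times \<Delta> = {real_of_int k * \<Delta> | k. True}"

definition numerical_solution ::
  "'w measure \<Rightarrow> (real \<Rightarrow> 'w measure) \<Rightarrow> real \<Rightarrow> real \<Rightarrow>
   (real \<Rightarrow> ('w \<Rightarrow> real \<Rightarrow> real ^ 'd) \<Rightarrow> real \<Rightarrow> 'w \<Rightarrow> real ^ 'd) \<Rightarrow> bool" where
  "numerical_solution M F \<tau> \<Delta> X \<longleftrightarrow>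
     (\<forall>s\<in>grid_times \<Delta>. 0 \<le> s \<longrightarrow> (\<forall>\<eta> \<in> F s \<rightarrow>\<^sub>M Cborel \<tau>.
        (\<forall>t\<ge>s - \<tau>. X s \<eta> t \<in> borel_measurable M) \<and>
        (\<forall>\<omega>\<in>space M. continuous_on {s - \<tau>..} (\<lambda>t. X s \<eta> t \<omega>)) \<and>
        (\<forall>\<omega>\<in>space M. \<forall>\<theta>\<in>{-\<tau>..0}. X s \<eta> (s + \<theta>) \<omega> = \<eta> \<omega> \<theta>) \<and>
        (\<forall>t\<in>grid_times \<Delta>. s \<le> t \<longrightarrow> segment \<tau> (X s \<eta>) t \<in> F t \<rightarrow>\<^sub>M Cborel \<tau>))) \<and>
     (\<forall>\<xi> \<in> F 0 \<rightarrow>\<^sub>M Cborel \<tau>. \<forall>s\<in>grid_times \<Delta>. 0 \<le> s \<longrightarrow>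
        (AE \<omega> in M. \<forall>t>s. X 0 \<xi> t \<omega> = X s (segment \<tau> (X 0 \<xi>) s) t \<omega>))"

text \<open>Time-homogeneous Markov chains with state space \<open>N\<close>, with respect to the natural filtration;
  \<open>\<kappa>\<close> is the one-step transition kernel.\<close>

definition natural_algebra ::
  "'w measure \<Rightarrow> 'c measure \<Rightarrow> (nat \<Rightarrow> 'w \<Rightarrow> 'c) \<Rightarrow> nat \<Rightarrow> 'w measure" where
  "natural_algebra M N Y k = sigma (space M) {Y j -` A \<inter> space M | j A. j \<le> k \<and> A \<in> sets N}"

definition homogeneous_markov :: "'w measure \<Rightarrow> 'c measure \<Rightarrow> (nat \<Rightarrow> 'w \<Rightarrow> 'c) \<Rightarrow> bool" where
  "homogeneous_markov M N Y \<longleftrightarrow>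
     (\<forall>k. Y k \<in> M \<rightarrow>\<^sub>M N) \<and>
     (\<exists>\<kappa> \<in> N \<rightarrow>\<^sub>M prob_algebra N. \<forall>k. \<forall>A\<in>sets N.
        AE \<omega> in M. real_cond_exp M (natural_algebra M N Y k)
                     (indicator (Y (Suc k) -` A \<inter> space M)) \<omega> = measure (\<kappa> (Y k \<omega>)) A)"

end

theory Submission
  imports Defs
begin

text \<open>Condition (iii) first extends from compact-valued to arbitrary initial data, since Borel probability
  measures on the Polish space \<open>C\<close> are tight and the solution on an event depends only on the initial data
  on that event. Now cut time into blocks of length \<open>T\<close>, a multiple of \<open>\<tau>\<close> so large that the exponential
  factors in (ii) and (iii), including the constant \<open>2\<^sup>p\<close> of the quasi-triangle inequality for \<open>E \<parallel>\<cdot>\<parallel>\<^sup>p\<close>,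
  drop below \<open>1/4\<close> and \<open>1/2\<close> over one block. Comparing the numerical solution on each block with the exact
  solution restarted from it, (ii) and (iv) give \<open>m\<^sub>j\<^sub>+\<^sub>1 \<le> m\<^sub>j/2 + const\<close> for its moments when \<open>\<Delta>\<close> is small, so
  these stay bounded. The flow property of both solutions, (iii) and (iv) then give
  \<open>e\<^sub>j\<^sub>+\<^sub>1 \<le> e\<^sub>j/2 + const \<cdot> \<Delta>\<^sup>q\<close> for the errors at the block ends, with \<open>e\<^sub>0 = 0\<close>.\<close>

section \<open>Measurability and tightness in separable metric spaces\<close>

text \<open>The segments at block ends are in general not compact-valued, even for bounded
  \<open>\<xi>\<close>, since bounded subsets of \<open>C\<close> need not be relatively compact; so
  (iii) does not apply directly to the restarts. Its extension survives the limit along growing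
  compact sets because \<open>K4\<close> and \<open>K5\<close> do not depend on the set. Replacing
  data off an event must not disturb the solution on it, which takes pasting of Ito integrals.
  \<open>Cborel\<close> is generated by open sets and not by coordinates, so separability of
  \<open>C\<close> enters before segments are known to be measurable. Two recursions are needed
  because (iv) measures the error of a block against moments of the numerical solution, while (ii)
  speaks of the exact one. \<open>C T\<close> may grow with \<open>T\<close> in any way:
  \<open>T\<close> is fixed before the threshold for \<open>\<Delta>\<close>, which then makes
  \<open>C T * \<Delta> powr q\<close> small. As (iv) looks back over one delay interval, the
  moments are tracked as suprema over windows of length \<open>\<tau>\<close> before the block ends,
  at the price of one \<open>\<tau>\<close> of decay in (ii).\<close>

lemma (in Metric_space) openin_eq_Union_mcball:
  assumes D: "D \<subseteq> M" "\<forall>x\<in>M. \<forall>e>0. \<exists>a\<in>D. d a x < e"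
    and U: "openin mtopology U"
  shows "U = (\<Union>i\<in>{i \<in> D \<times> (UNIV :: nat set). mcball (fst i) (1 / Suc (snd i)) \<subseteq> U}. mcball (fst i) (1 / Suc (snd i)))"
proof (intro equalityI subsetI)
  fix x assume x: "x \<in> U"
  then obtain r where r: "0 < r" "mball x r \<subseteq> U" and xM: "x \<in> M"
    using U unfolding openin_mtopology by blast
  \<comment> \<open>Half of \<open>r\<close>: both \<open>x\<close> and any point of the closed ball
    lie within \<open>1 / Suc n\<close> of the centre, so two radii must fit into
    \<open>r\<close>.\<close>
  obtain n where n: "1 / Suc n < r / 2"
    using r nat_approx_posE[of "r / 2"] by auto
  obtain a where a: "a \<in> D" "d a x < 1 / Suc n"
    using D(2) xM by (metis of_nat_0_less_iff zero_less_Suc zero_less_divide_1_iff)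
  then have aM: "a \<in> M" using D(1) by auto
  have "mcball a (1 / Suc n) \<subseteq> mball x r"
  proof
    fix y assume "y \<in> mcball a (1 / Suc n)"
    then have y: "y \<in> M" "d a y \<le> 1 / Suc n" by auto
    have "d x y \<le> d x a + d a y" using xM aM y by (intro triangle)
    also have "\<dots> < r" using a(2) y(2) n commute[of x a] by linarith
    finally show "y \<in> mball x r" using xM y by auto
  qed
  moreover have "x \<in> mcball a (1 / Suc n)" using a aM xM by auto
  ultimately show "x \<in> (\<Union>i\<in>{i \<in> D \<times> (UNIV :: nat set). mcball (fst i) (1 / Suc (snd i)) \<subseteq> U}. mcball (fst i) (1 / Suc (snd i)))"
    using r a by (intro UN_I[of "(a, n)"]) auto
qed auto

text \<open>Closed balls around points of \<open>D\<close> are sublevel sets of countably many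
  distance functions, and by separability every open set is a countable union of such balls.\<close>

lemma (in Metric_space) measurable_sigma_openin:
  assumes D: "countable D" "D \<subseteq> M" "\<forall>x\<in>M. \<forall>e>0. \<exists>a\<in>D. d a x < e"
    and Y: "\<And>\<omega>. \<omega> \<in> space N \<Longrightarrow> Y \<omega> \<in> M"
    and dist: "\<And>a. a \<in> D \<Longrightarrow> (\<lambda>\<omega>. d a (Y \<omega>)) \<in> borel_measurable N"
  shows "Y \<in> N \<rightarrow>\<^sub>M sigma M {U. openin mtopology U}"
proof (rule measurable_measure_of)
  fix U assume "U \<in> {U. openin mtopology U}"
  then have U: "openin mtopology U" by simp
  let ?I = "{i \<in> D \<times> (UNIV :: nat set). mcball (fst i) (1 / Suc (snd i)) \<subseteq> U}"
  have cnt: "countable ?I"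
    by (rule countable_subset[of _ "D \<times> UNIV"]) (use D in auto)
  have "Y -` mcball a r \<inter> space N = {\<omega> \<in> space N. d a (Y \<omega>) \<le> r}" if "a \<in> D" for a r
    using that D(2) Y by (auto simp: in_mcball)
  then have ball: "Y -` mcball a r \<inter> space N \<in> sets N" if "a \<in> D" for a r
    using that dist[OF that] by simp
  have "U = (\<Union>i\<in>?I. mcball (fst i) (1 / Suc (snd i)))"
    by (rule openin_eq_Union_mcball[OF D(2,3) U])
  then have "Y -` U \<inter> space N = Y -` (\<Union>i\<in>?I. mcball (fst i) (1 / Suc (snd i))) \<inter> space N"
    by (rule arg_cong)
  also have "\<dots> = (\<Union>i\<in>?I. Y -` (mcball (fst i) (1 / Suc (snd i))) \<inter> space N)"
    unfolding vimage_UN by blast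
  also have "\<dots> \<in> sets N"
    using cnt by (intro sets.countable_UN'') (auto intro!: ball)
  finally show "Y -` U \<inter> space N \<in> sets N" .
qed (use Y in \<open>auto simp: openin_mtopology\<close>)

lemma (in Metric_space) closedin_in_sets_sigma_openin:
  assumes "closedin mtopology K"
  shows "K \<in> sets (sigma M {U. openin mtopology U})"
proof -
  have o: "openin mtopology (M - K)" and K: "K \<subseteq> M"
    using assms by (auto simp: closedin_def)
  have "M - (M - K) \<in> sigma_sets M {U. openin mtopology U}"
    using o by (intro sigma_sets.Compl sigma_sets.Basic) simp
  moreover have "M - (M - K) = K" using K by auto
  moreover have "{U. openin mtopology U} \<subseteq> Pow M" by (auto simp: openin_mtopology)
  ultimately show ?thesis by (simp add: sets_measure_of)
qed

text \<open>Ulam's theorem. For each radius finitely many balls around points of \<open>D\<close> carry almost all the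
  mass, and the intersection of these finite unions is closed and totally bounded.\<close>

lemma (in Metric_space) tight_sigma_openin:
  assumes D: "countable D" "D \<subseteq> M" "\<forall>x\<in>M. \<forall>e>0. \<exists>a\<in>D. d a x < e"
    and complete: "mcomplete" and N: "prob_space N"
    and Y: "Y \<in> N \<rightarrow>\<^sub>M sigma M {U. openin mtopology U}" and e: "0 < e"
  shows "\<exists>K. compactin mtopology K \<and> measure N {\<omega>\<in>space N. Y \<omega> \<notin> K} \<le> e"
proof -
  interpret N: prob_space N by fact
  have YM: "Y \<omega> \<in> M" if "\<omega> \<in> space N" for \<omega>
    using measurable_space[OF Y that] by (auto simp: space_measure_of_conv)
  have "M \<noteq> {}" using YM N.not_empty by auto
  then have "D \<noteq> {}" using D(3) by (metis all_not_in_conv zero_less_one)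
  define b where "b = from_nat_into D"
  have b: "b i \<in> M" for i using from_nat_into[OF \<open>D \<noteq> {}\<close>] D(2) by (auto simp: b_def)
  have b_dense: "\<exists>i. d (b i) x < r" if x: "x \<in> M" "0 < r" for x r
  proof -
    obtain a where a: "a \<in> D" "d a x < r" using D(3) x by blast
    obtain i where "from_nat_into D i = a" using from_nat_into_surj[OF D(1) a(1)] by blast
    with a show ?thesis by (auto simp: b_def)
  qed
  define A where "A n m = (\<Union>i\<le>m. mcball (b i) (1 / Suc n))" for n m :: nat
  have A_mono: "A n k \<subseteq> A n l" if "k \<le> l" for n k l
    using that unfolding A_def by (intro UN_mono) auto
  have A_closed: "closedin mtopology (A n m)" for n m
    unfolding A_def by (intro closedin_Union) auto
  have sets_pre: "{\<omega>\<in>space N. Y \<omega> \<notin> K} \<in> sets N" if "closedin mtopology K" for K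
  proof -
    have "space N - (Y -` K \<inter> space N) \<in> sets N"
      using measurable_sets[OF Y closedin_in_sets_sigma_openin[OF that]] by auto
    moreover have "space N - (Y -` K \<inter> space N) = {\<omega>\<in>space N. Y \<omega> \<notin> K}" by auto
    ultimately show ?thesis by simp
  qed
  \<comment> \<open>The sets \<open>A n m\<close> grow with \<open>m\<close> and by density exhaust
    the space, so continuity from above applies to the complements. The budgets
    \<open>e * (1/2) ^ Suc n\<close> add up to \<open>e\<close>.\<close>
  have "\<exists>m. measure N {\<omega>\<in>space N. Y \<omega> \<notin> A n m} < e * (1/2) ^ Suc n" for n
  proof -
    let ?B = "\<lambda>m. {\<omega>\<in>space N. Y \<omega> \<notin> A n m}"
    have "(\<lambda>m. measure N (?B m)) \<longlonglongrightarrow> measure N (\<Inter>m. ?B m)"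
    proof (rule N.finite_Lim_measure_decseq)
      show "range ?B \<subseteq> sets N" using sets_pre[OF A_closed] by auto
      show "decseq ?B" using A_mono unfolding decseq_def by blast
    qed
    also have "(\<Inter>m. ?B m) = {}"
    proof (intro equals0I)
      fix \<omega> assume w: "\<omega> \<in> (\<Inter>m. ?B m)"
      then have wN: "\<omega> \<in> space N" by auto
      obtain i where "d (b i) (Y \<omega>) < 1 / Suc n" using b_dense[OF YM[OF wN], of "1 / Suc n"] by auto
      then have "Y \<omega> \<in> A n i" using b YM[OF wN] unfolding A_def by (intro UN_I[of i]) auto
      then show False using w by auto
    qed
    finally have "(\<lambda>m. measure N (?B m)) \<longlonglongrightarrow> 0" by simp
    moreover have "0 < e * (1/2) ^ Suc n" using e by simp
    ultimately have "\<forall>\<^sub>F m in sequentially. measure N (?B m) < e * (1/2) ^ Suc n"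
      by (rule order_tendstoD)
    then show ?thesis by (auto simp: eventually_sequentially)
  qed
  then obtain m where m: "\<And>n. measure N {\<omega>\<in>space N. Y \<omega> \<notin> A n (m n)} < e * (1/2) ^ Suc n"
    by metis
  define K where "K = (\<Inter>n. A n (m n))"
  have K_closed: "closedin mtopology K" unfolding K_def using A_closed by (intro closedin_Inter) auto
  then have KM: "K \<subseteq> M" using closedin_subset by fastforce
  have "mtotally_bounded K"
    unfolding mtotally_bounded_def
  proof (intro allI impI)
    fix r :: real assume "0 < r"
    then obtain n where n: "1 / Suc n < r / 2" using nat_approx_posE[of "r / 2"] by auto
    \<comment> \<open>Total boundedness asks for centres inside \<open>K\<close>. Each covering ball
      that meets \<open>K\<close> gets a centre \<open>c i\<close> in the intersection, which
      doubles the radius.\<close>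
    define J where "J = {i. i \<le> m n \<and> K \<inter> mcball (b i) (1 / Suc n) \<noteq> {}}"
    have "\<forall>i\<in>J. \<exists>y. y \<in> K \<inter> mcball (b i) (1 / Suc n)" unfolding J_def by blast
    then obtain c where c: "\<And>i. i \<in> J \<Longrightarrow> c i \<in> K \<inter> mcball (b i) (1 / Suc n)"
      using bchoice[of J "\<lambda>i y. y \<in> K \<inter> mcball (b i) (1 / Suc n)"] by blast
    show "\<exists>K'. finite K' \<and> K' \<subseteq> K \<and> K \<subseteq> (\<Union>x\<in>K'. mball x r)"
    proof (intro exI conjI subsetI)
      show "finite (c ` J)" by (simp add: J_def)
      fix y assume y: "y \<in> K"
      then obtain i where i: "i \<le> m n" "y \<in> mcball (b i) (1 / Suc n)"
        by (auto simp: K_def A_def)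
      then have iJ: "i \<in> J" using y by (auto simp: J_def)
      have cM: "c i \<in> M" "y \<in> M" using c[OF iJ] i by auto
      have "d (c i) y \<le> d (c i) (b i) + d (b i) y" using cM b by (intro triangle) auto
      also have "\<dots> < r" using c[OF iJ] i(2) n commute[of "c i" "b i"] by auto
      finally show "y \<in> (\<Union>x\<in>c ` J. mball x r)" using iJ cM by auto
    qed (use c in auto)
  qed
  \<comment> \<open>In a complete space the closure of a totally bounded set is compact, and
    \<open>K\<close> is its own closure.\<close>
  then have "compactin mtopology K"
    using mtotally_bounded_eq_compact_closure_of[OF complete] closure_of_closedin[OF K_closed] by simp
  moreover have "measure N {\<omega>\<in>space N. Y \<omega> \<notin> K} \<le> e"
  proof -
    have sums: "(\<lambda>n. e * (1/2) ^ Suc n) sums e"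
      using sums_mult[OF power_half_series, of e] by simp
    have summ: "summable (\<lambda>n. measure N {\<omega>\<in>space N. Y \<omega> \<notin> A n (m n)})"
      by (rule summable_comparison_test'[OF sums_summable[OF sums], of 0]) (use m in \<open>auto intro: less_imp_le\<close>)
    have "{\<omega>\<in>space N. Y \<omega> \<notin> K} = (\<Union>n. {\<omega>\<in>space N. Y \<omega> \<notin> A n (m n)})"
      by (auto simp: K_def)
    also have "measure N \<dots> \<le> (\<Sum>n. measure N {\<omega>\<in>space N. Y \<omega> \<notin> A n (m n)})"
      using sets_pre[OF A_closed] summ by (intro N.finite_measure_subadditive_countably) auto
    also have "\<dots> \<le> (\<Sum>n. e * (1/2) ^ Suc n)"
      using m summ sums_summable[OF sums] by (intro suminf_le) (auto intro: less_imp_le)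
    also have "\<dots> = e" using sums by (rule sums_unique[symmetric])
    finally show ?thesis .
  qed
  ultimately show ?thesis by auto
qed

section \<open>The Borel space of continuous paths\<close>

lemma Cnorm_le:
  assumes "0 \<le> \<tau>" "\<And>\<theta>. \<theta> \<in> {-\<tau>..0} \<Longrightarrow> norm (\<phi> \<theta>) \<le> B"
  shows "Cnorm \<tau> \<phi> \<le> B"
  unfolding Cnorm_def using assms by (intro cSUP_least) auto

lemma norm_le_Cnorm:
  assumes "continuous_on {-\<tau>..0} \<phi>" "\<theta> \<in> {-\<tau>..0}"
  shows "norm (\<phi> \<theta>) \<le> Cnorm \<tau> \<phi>"
proof -
  have "bounded (\<phi> ` {-\<tau>..0})"
    using assms by (intro compact_imp_bounded compact_continuous_image) auto
  then have "bdd_above ((\<lambda>\<theta>. norm (\<phi> \<theta>)) ` {-\<tau>..0})"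
    by (auto simp: bounded_iff bdd_above_def)
  with assms(2) show ?thesis unfolding Cnorm_def by (intro cSUP_upper)
qed

lemma Cnorm_le_iff:
  assumes "0 \<le> \<tau>" "continuous_on {-\<tau>..0} \<phi>"
  shows "Cnorm \<tau> \<phi> \<le> B \<longleftrightarrow> (\<forall>\<theta>\<in>{-\<tau>..0}. norm (\<phi> \<theta>) \<le> B)"
  using Cnorm_le[OF assms(1), of \<phi> B] norm_le_Cnorm[OF assms(2)] by (meson order_trans)

lemma Cnorm_nonneg:
  assumes "0 \<le> \<tau>" "continuous_on {-\<tau>..0} \<phi>"
  shows "0 \<le> Cnorm \<tau> \<phi>"
  using order_trans[OF norm_ge_zero norm_le_Cnorm[OF assms(2), of 0]] assms(1) by auto

lemma Cnorm_cong:
  assumes "\<And>\<theta>. \<theta> \<in> {-\<tau>..0} \<Longrightarrow> \<phi> \<theta> = \<psi> \<theta>"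
  shows "Cnorm \<tau> \<phi> = Cnorm \<tau> \<psi>"
  unfolding Cnorm_def using assms by (intro SUP_cong) auto

lemma Cnorm_add_le:
  assumes "0 \<le> \<tau>" "continuous_on {-\<tau>..0} \<phi>" "continuous_on {-\<tau>..0} \<psi>"
  shows "Cnorm \<tau> (\<lambda>\<theta>. \<phi> \<theta> + \<psi> \<theta>) \<le> Cnorm \<tau> \<phi> + Cnorm \<tau> \<psi>"
  using assms
  by (intro Cnorm_le order_trans[OF norm_triangle_ineq] add_mono norm_le_Cnorm) auto

text \<open>Bounding the sum by twice the maximum takes no convexity, so \<open>p < 1\<close> is
  covered as well; this is the source of the factor \<open>2 powr p\<close>.\<close>

lemma powr_add_le_2_powr:
  fixes a b p :: real
  assumes "0 \<le> a" "0 \<le> b" "0 < p"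
  shows "(a + b) powr p \<le> 2 powr p * (a powr p + b powr p)"
proof -
  have "(a + b) powr p \<le> (2 * max a b) powr p"
    using assms by (intro powr_mono2) auto
  also have "\<dots> = 2 powr p * max a b powr p" using assms by (simp add: powr_mult)
  also have "max a b powr p \<le> a powr p + b powr p" by (simp add: max_def)
  finally show ?thesis by simp
qed

text \<open>By continuity a bound on the norm over a countable dense set of times holds on the whole
  interval, so a sublevel set of the supremum is a countable intersection of coordinate
  events.\<close>

lemma borel_measurable_Cnorm:
  fixes Y :: "'w \<Rightarrow> real \<Rightarrow> real ^ 'd"
  assumes \<tau>: "0 \<le> \<tau>"
    and Y: "\<And>\<theta>. \<theta> \<in> {-\<tau>..0} \<Longrightarrow> (\<lambda>\<omega>. Y \<omega> \<theta>) \<in> borel_measurable N"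
    and cont: "\<And>\<omega>. \<omega> \<in> space N \<Longrightarrow> continuous_on {-\<tau>..0} (Y \<omega>)"
  shows "(\<lambda>\<omega>. Cnorm \<tau> (Y \<omega>)) \<in> borel_measurable N"
  unfolding borel_measurable_iff_le
proof
  fix a :: real
  obtain T where T: "countable T" "T \<subseteq> {-\<tau>..0}" "{-\<tau>..0} \<subseteq> closure T"
    using separable[of "{-\<tau>..0}"] by auto
  have "Cnorm \<tau> (Y \<omega>) \<le> a \<longleftrightarrow> (\<forall>\<theta>\<in>T. norm (Y \<omega> \<theta>) \<le> a)" if \<omega>: "\<omega> \<in> space N" for \<omega>
  proof -
    have "{-\<tau>..0} \<subseteq> {-\<tau>..0} \<inter> {\<theta>\<in>{-\<tau>..0}. norm (Y \<omega> \<theta>) \<le> a}" if "\<forall>\<theta>\<in>T. norm (Y \<omega> \<theta>) \<le> a"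
    proof -
      have "closed {\<theta>\<in>{-\<tau>..0}. norm (Y \<omega> \<theta>) \<le> a}"
        using cont[OF \<omega>] by (intro closed_Collect_le continuous_on_closed_Collect_le continuous_intros) auto
      then have "closure T \<subseteq> {\<theta>\<in>{-\<tau>..0}. norm (Y \<omega> \<theta>) \<le> a}"
        using T that by (intro closure_minimal) auto
      then show ?thesis using T(3) by auto
    qed
    then show ?thesis unfolding Cnorm_le_iff[OF \<tau> cont[OF \<omega>]] using T(2) by blast
  qed
  then have "{\<omega> \<in> space N. Cnorm \<tau> (Y \<omega>) \<le> a} = {\<omega> \<in> space N. \<forall>\<theta>\<in>T. norm (Y \<omega> \<theta>) \<le> a}"
    by auto
  also have "\<dots> = space N - (\<Union>\<theta>\<in>T. {\<omega> \<in> space N. \<not> norm (Y \<omega> \<theta>) \<le> a})"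
    by auto
  also have "\<dots> \<in> sets N"
  proof (intro sets.Diff sets.top sets.countable_UN'' T(1))
    fix \<theta> assume "\<theta> \<in> T"
    then have [measurable]: "(\<lambda>\<omega>. Y \<omega> \<theta>) \<in> borel_measurable N" using Y T(2) by blast
    show "{\<omega> \<in> space N. \<not> norm (Y \<omega> \<theta>) \<le> a} \<in> sets N" by measurable
  qed
  finally show "{\<omega> \<in> space N. Cnorm \<tau> (Y \<omega>) \<le> a} \<in> sets N" .
qed

text \<open>Sort the functions by their oscillation at mesh \<open>n\<close> and their approximate
  nodal values \<open>qs\<close>, both up to \<open>1 / Suc k\<close>. Two functions of the same
  class differ by at most \<open>4 / Suc k\<close>, so an arbitrary member of each nonempty class
  will do, and there are countably many classes.\<close>

lemma Cspace_separable:
  assumes \<tau>: "0 < \<tau>"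
  obtains D :: "(real \<Rightarrow> real ^ 'd) set"
  where "countable D" "D \<subseteq> mspace (Cspace \<tau>)"
    "\<forall>\<phi>\<in>mspace (Cspace \<tau>). \<forall>e>0. \<exists>a\<in>D. mdist (Cspace \<tau>) a \<phi> < e"
proof -
  obtain Q :: "(real ^ 'd) set" where Q: "countable Q" "\<And>U. open U \<Longrightarrow> U \<noteq> {} \<Longrightarrow> \<exists>q\<in>Q. q \<in> U"
    using countable_dense_exists by blast
  have Qd: "\<exists>q\<in>Q. dist y q < e" if "0 < e" for y :: "real ^ 'd" and e
    using Q(2)[of "ball y e"] that by auto
  \<comment> \<open>The \<open>n + 2\<close> nodes split the interval into \<open>n + 1\<close>
    pieces of length \<open>\<tau> / Suc n\<close>.\<close>
  define pt where "pt n j = - (\<tau> * real j / real (Suc n))" for n j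
  have pt: "pt n j \<in> {-\<tau>..0}" if "j \<le> Suc n" for n j
    using \<tau> that by (auto simp: pt_def divide_le_eq)
  have near: "\<exists>j\<le>Suc n. \<bar>\<theta> - pt n j\<bar> \<le> \<tau> / Suc n" if "\<theta> \<in> {-\<tau>..0}" for \<theta> n
  proof -
    define r where "r = - \<theta> * Suc n / \<tau>"
    have "- \<theta> * Suc n \<le> \<tau> * Suc n" using that by (intro mult_right_mono) auto
    then have r: "0 \<le> r" "r \<le> Suc n" "\<theta> = - (\<tau> * r / Suc n)"
      using that \<tau> by (auto simp: r_def divide_simps mult_nonpos_nonneg mult.commute)
    define j where "j = nat \<lfloor>r\<rfloor>"
    have j: "real j \<le> r" "r \<le> real j + 1"
      using r(1) by (auto simp: j_def)
    have "real j \<le> real (Suc n)" using j(1) r(2) by linarith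
    then have "j \<le> Suc n" by simp
    moreover have "\<theta> - pt n j = - (\<tau> / Suc n) * (r - j)"
      by (simp add: r(3) pt_def field_simps del: of_nat_Suc)
    then have "\<bar>\<theta> - pt n j\<bar> = \<tau> / Suc n * \<bar>r - j\<bar>" using \<tau> by (simp add: abs_mult)
    then have "\<bar>\<theta> - pt n j\<bar> \<le> \<tau> / Suc n * 1" using \<tau> j by (simp only:) (intro mult_left_mono, auto)
    ultimately show ?thesis by auto
  qed
  define P where "P n k qs \<phi> \<longleftrightarrow> \<phi> \<in> mspace (Cspace \<tau>) \<and>
      (\<forall>s\<in>{-\<tau>..0}. \<forall>t\<in>{-\<tau>..0}. \<bar>s - t\<bar> \<le> \<tau> / Suc n \<longrightarrow> norm (\<phi> s - \<phi> t) \<le> 1 / Suc k) \<and>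
      (\<forall>j\<le>Suc n. norm (\<phi> (pt n j) - qs ! j) \<le> 1 / Suc k)"
    for n k :: nat and qs and \<phi> :: "real \<Rightarrow> real ^ 'd"
  \<comment> \<open>\<open>D\<close> contains one function for every mesh \<open>n\<close>, accuracy \<open>k\<close> and list \<open>qs\<close> of nodal values that some
    function matches.\<close>
  define I where "I = {(n, k, qs). qs \<in> lists Q \<and> (\<exists>\<phi>. P n k qs \<phi>)}"
  define D where "D = (\<lambda>(n, k, qs). SOME \<phi>. P n k qs \<phi>) ` I"
  have PD: "P n k qs (SOME \<phi>. P n k qs \<phi>)" if "(n, k, qs) \<in> I" for n k qs
    using that someI_ex[of "P n k qs"] by (auto simp: I_def)
  show thesis
  proof (rule that)
    have "countable I"
      by (rule countable_subset[of _ "UNIV \<times> UNIV \<times> lists Q"]) (auto simp: I_def Q(1))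
    then show "countable D" unfolding D_def by (rule countable_image)
    show "D \<subseteq> mspace (Cspace \<tau>)"
      using PD by (force simp: D_def P_def)
    show "\<forall>\<phi>\<in>mspace (Cspace \<tau>). \<forall>e>0. \<exists>a\<in>D. mdist (Cspace \<tau>) a \<phi> < e"
    proof (intro ballI allI impI)
      fix \<phi> :: "real \<Rightarrow> real ^ 'd" and e :: real
      assume \<phi>: "\<phi> \<in> mspace (Cspace \<tau>)" and e: "0 < e"
      \<comment> \<open>Four errors of size at most \<open>1 / Suc k\<close> add up below, and
        \<open>e / 5\<close> keeps their sum under \<open>e\<close>.\<close>
      obtain k where k: "1 / Suc k < e / 5" using nat_approx_posE[of "e / 5"] e by auto
      have "uniformly_continuous_on {-\<tau>..0} \<phi>"
        using \<phi> by (intro compact_uniformly_continuous) (auto simp: mspace_Cspace)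
      then obtain \<delta> where \<delta>: "0 < \<delta>"
          "\<And>s t. s \<in> {-\<tau>..0} \<Longrightarrow> t \<in> {-\<tau>..0} \<Longrightarrow> dist s t < \<delta> \<Longrightarrow> dist (\<phi> s) (\<phi> t) < 1 / Suc k"
        unfolding uniformly_continuous_on_def by (metis of_nat_0_less_iff zero_less_Suc zero_less_divide_1_iff)
      obtain n where "1 / Suc n < \<delta> / \<tau>" using nat_approx_posE[of "\<delta> / \<tau>"] \<delta>(1) \<tau> by auto
      then have n: "\<tau> / Suc n < \<delta>" using \<tau> by (simp add: field_simps)
      have "\<exists>q. q \<in> Q \<and> dist (\<phi> (pt n j)) q < 1 / Suc k" for j
        using Qd[of "1 / Suc k" "\<phi> (pt n j)"] by auto
      then obtain c where c: "\<And>j. c j \<in> Q" "\<And>j. dist (\<phi> (pt n j)) (c j) < 1 / Suc k"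
        by metis
      define qs where "qs = map c [0..<Suc (Suc n)]"
      have qs_nth: "qs ! j = c j" if "j \<le> Suc n" for j
        using that unfolding qs_def by (subst nth_map) (auto simp del: upt_Suc)
      have P\<phi>: "P n k qs \<phi>"
        unfolding P_def
      proof (intro conjI ballI impI allI)
        fix s t assume "s \<in> {-\<tau>..0}" "t \<in> {-\<tau>..0}" "\<bar>s - t\<bar> \<le> \<tau> / Suc n"
        then show "norm (\<phi> s - \<phi> t) \<le> 1 / Suc k"
          using \<delta>(2)[of s t] n by (simp add: dist_norm del: of_nat_Suc)
      next
        fix j assume "j \<le> Suc n"
        then show "norm (\<phi> (pt n j) - qs ! j) \<le> 1 / Suc k"
          using c(2)[of j] by (simp add: qs_nth dist_norm del: of_nat_Suc)
      qed (rule \<phi>)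
      have "qs \<in> lists Q" using c(1) by (auto simp: qs_def)
      then have nI: "(n, k, qs) \<in> I" using P\<phi> by (auto simp: I_def)
      define a where "a = (SOME \<phi>. P n k qs \<phi>)"
      have Pa: "P n k qs a" unfolding a_def by (rule PD[OF nI])
      have aD: "a \<in> D" using nI by (force simp: D_def a_def)
      have "mdist (Cspace \<tau>) a \<phi> = Cnorm \<tau> (\<lambda>\<theta>. a \<theta> - \<phi> \<theta>)"
        using \<phi> Pa \<tau> by (intro mdist_Cspace) (auto simp: P_def)
      also have "\<dots> \<le> 4 * (1 / Suc k)"
      proof (rule Cnorm_le)
        fix \<theta> assume \<theta>: "\<theta> \<in> {-\<tau>..0}"
        then obtain j where j: "j \<le> Suc n" "\<bar>\<theta> - pt n j\<bar> \<le> \<tau> / Suc n" using near by blast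
        have 1: "norm (\<phi> \<theta> - \<phi> (pt n j)) \<le> 1 / Suc k" "norm (\<phi> (pt n j) - qs ! j) \<le> 1 / Suc k"
          using P\<phi> \<theta> j pt[OF j(1)] unfolding P_def by auto
        have 2: "norm (a \<theta> - a (pt n j)) \<le> 1 / Suc k" "norm (a (pt n j) - qs ! j) \<le> 1 / Suc k"
          using Pa \<theta> j pt[OF j(1)] unfolding P_def by auto
        \<comment> \<open>Four legs: from \<open>a \<theta>\<close> to the value of \<open>a\<close>
          at the node, to \<open>qs ! j\<close>, to the value of \<open>\<phi>\<close> at the node,
          to \<open>\<phi> \<theta>\<close>.\<close>
        have "norm (a \<theta> - \<phi> \<theta>) = norm ((a \<theta> - a (pt n j)) + (a (pt n j) - qs ! j)
            - ((\<phi> \<theta> - \<phi> (pt n j)) + (\<phi> (pt n j) - qs ! j)))" by simp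
        also have "\<dots> \<le> (norm (a \<theta> - a (pt n j)) + norm (a (pt n j) - qs ! j))
            + (norm (\<phi> \<theta> - \<phi> (pt n j)) + norm (\<phi> (pt n j) - qs ! j))"
          by (intro order_trans[OF norm_triangle_ineq4] add_mono norm_triangle_ineq)
        also have "\<dots> \<le> 4 * (1 / Suc k)" using 1 2 by linarith
        finally show "norm (a \<theta> - \<phi> \<theta>) \<le> 4 * (1 / Suc k)" .
      qed (use \<tau> in auto)
      also have "\<dots> < e" using k e by linarith
      finally show "\<exists>a\<in>D. mdist (Cspace \<tau>) a \<phi> < e" using aD by auto
    qed
  qed
qed

lemma Cborel_eq:
  "Cborel \<tau> = sigma (mspace (Cspace \<tau>))
     {U. openin (Metric_space.mtopology (mspace (Cspace \<tau>)) (mdist (Cspace \<tau>))) U}"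
  by (simp add: Cborel_def mtopology_of_def)

lemma space_Cborel: "space (Cborel \<tau>) = mspace (Cspace \<tau>)"
  by (simp add: Cborel_def space_measure_of_conv)

text \<open>The distance to a fixed \<open>a\<close> is the \<open>Cnorm\<close> of coordinate
  differences, hence measurable, and separability does the rest. Adaptedness controls the
  coordinates of a segment, so this is what makes segments random variables in
  \<open>C\<close>.\<close>

lemma measurable_CborelI:
  fixes Y :: "'w \<Rightarrow> real \<Rightarrow> real ^ 'd"
  assumes \<tau>: "0 < \<tau>"
    and Y: "\<And>\<omega>. \<omega> \<in> space N \<Longrightarrow> Y \<omega> \<in> mspace (Cspace \<tau>)"
    and coord: "\<And>\<theta>. \<theta> \<in> {-\<tau>..0} \<Longrightarrow> (\<lambda>\<omega>. Y \<omega> \<theta>) \<in> borel_measurable N"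
  shows "Y \<in> N \<rightarrow>\<^sub>M Cborel \<tau>"
proof -
  interpret Metric_space "mspace (Cspace \<tau>)" "mdist (Cspace \<tau>) :: (real \<Rightarrow> real ^ 'd) \<Rightarrow> _"
    by (rule Metric_space_mspace_mdist)
  obtain D :: "(real \<Rightarrow> real ^ 'd) set" where D: "countable D" "D \<subseteq> mspace (Cspace \<tau>)"
    "\<forall>\<phi>\<in>mspace (Cspace \<tau>). \<forall>e>0. \<exists>a\<in>D. mdist (Cspace \<tau>) a \<phi> < e"
    using Cspace_separable[OF \<tau>] by blast
  show ?thesis
    unfolding Cborel_eq
  proof (rule measurable_sigma_openin[OF D Y])
    fix a assume "a \<in> D"
    then have a: "a \<in> mspace (Cspace \<tau>)" using D(2) by auto
    have "(\<lambda>\<omega>. Cnorm \<tau> (\<lambda>\<theta>. a \<theta> - Y \<omega> \<theta>)) \<in> borel_measurable N"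
      using a Y coord \<tau>
      by (intro borel_measurable_Cnorm) (auto simp: mspace_Cspace intro!: continuous_intros)
    then show "(\<lambda>\<omega>. mdist (Cspace \<tau>) a (Y \<omega>)) \<in> borel_measurable N"
      by (rule measurable_cong[THEN iffD1, rotated])
        (use a Y \<tau> in \<open>auto simp: mdist_Cspace\<close>)
  qed
qed

text \<open>Evaluation at \<open>\<theta>\<close> is 1-Lipschitz for the supremum metric, so
  preimages of open sets are open.\<close>

lemma measurable_Cborel_eval:
  fixes Y :: "'w \<Rightarrow> real \<Rightarrow> real ^ 'd"
  assumes \<tau>: "0 \<le> \<tau>" and \<theta>: "\<theta> \<in> {-\<tau>..0}" and Y: "Y \<in> N \<rightarrow>\<^sub>M Cborel \<tau>"
  shows "(\<lambda>\<omega>. Y \<omega> \<theta>) \<in> borel_measurable N"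
proof -
  interpret Metric_space "mspace (Cspace \<tau>)" "mdist (Cspace \<tau>) :: (real \<Rightarrow> real ^ 'd) \<Rightarrow> _"
    by (rule Metric_space_mspace_mdist)
  have "(\<lambda>\<phi>::real \<Rightarrow> real ^ 'd. \<phi> \<theta>) \<in> borel_measurable (Cborel \<tau>)"
  proof (rule borel_measurableI)
    fix S :: "(real ^ 'd) set" assume S: "open S"
    let ?U = "(\<lambda>\<phi>. \<phi> \<theta>) -` S \<inter> space (Cborel \<tau>)"
    have "openin mtopology ?U"
      unfolding openin_mtopology
    proof (intro conjI allI impI)
      fix \<phi> assume \<phi>: "\<phi> \<in> ?U"
      then obtain e where e: "0 < e" "ball (\<phi> \<theta>) e \<subseteq> S" using S by (auto simp: open_contains_ball)
      have "mball \<phi> e \<subseteq> ?U"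
      proof
        fix \<psi> assume \<psi>: "\<psi> \<in> mball \<phi> e"
        then have "Cnorm \<tau> (\<lambda>\<theta>. \<phi> \<theta> - \<psi> \<theta>) < e" using mdist_Cspace[OF \<tau>, of \<phi> \<psi>] by auto
        moreover have "\<phi> \<in> mspace (Cspace \<tau>)" "\<psi> \<in> mspace (Cspace \<tau>)" using \<psi> by auto
        then have "norm (\<phi> \<theta> - \<psi> \<theta>) \<le> Cnorm \<tau> (\<lambda>\<theta>. \<phi> \<theta> - \<psi> \<theta>)"
          using \<theta> by (intro norm_le_Cnorm[where \<phi>="\<lambda>\<theta>. \<phi> \<theta> - \<psi> \<theta>"] continuous_intros) (auto simp: mspace_Cspace)
        ultimately show "\<psi> \<in> ?U" using e \<psi> by (auto simp: space_Cborel dist_norm)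
      qed
      with e(1) show "\<exists>r>0. mball \<phi> r \<subseteq> ?U" by auto
    qed (auto simp: space_Cborel)
    then have "?U \<in> {U. openin mtopology U}" by simp
    moreover have "{U. openin mtopology U} \<subseteq> Pow (mspace (Cspace \<tau>))" by (auto simp: openin_mtopology)
    ultimately show "?U \<in> sets (Cborel \<tau>)"
      by (subst Cborel_eq, subst sets_measure_of) (auto intro: sigma_sets.Basic)
  qed
  then show ?thesis by (rule measurable_compose[OF Y])
qed

lemma tight_Cborel:
  fixes Y :: "'w \<Rightarrow> real \<Rightarrow> real ^ 'd"
  assumes \<tau>: "0 < \<tau>" and N: "prob_space N" and Y: "Y \<in> N \<rightarrow>\<^sub>M Cborel \<tau>" and e: "0 < e"
  obtains K where "compactin (mtopology_of (Cspace \<tau>)) K"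
    "measure N {\<omega>\<in>space N. Y \<omega> \<notin> K} \<le> e"
proof -
  interpret Metric_space "mspace (Cspace \<tau>)" "mdist (Cspace \<tau>) :: (real \<Rightarrow> real ^ 'd) \<Rightarrow> _"
    by (rule Metric_space_mspace_mdist)
  obtain D :: "(real \<Rightarrow> real ^ 'd) set" where D: "countable D" "D \<subseteq> mspace (Cspace \<tau>)"
    "\<forall>\<phi>\<in>mspace (Cspace \<tau>). \<forall>e>0. \<exists>a\<in>D. mdist (Cspace \<tau>) a \<phi> < e"
    using Cspace_separable[OF \<tau>] by blast
  \<comment> \<open>The completeness result for continuous functions speaks of the metric
    \<open>Met_TC.Self\<close>, which has to be recognised as
    \<open>euclidean_metric\<close>.\<close>
  have "Met_TC.Self = (euclidean_metric :: (real ^ 'd) metric)"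
    by (simp add: Met_TC.Self_def euclidean_metric_def)
  then have "mcomplete_of (Cspace \<tau> :: (real \<Rightarrow> real ^ 'd) metric)"
    using Met_TC.mcomplete_cfunspace[of "top_of_set {-\<tau>..0}", where ?'a="real ^ 'd"] complete_UNIV
    unfolding Cspace_def by simp
  then have "mcomplete" by (simp add: mcomplete_of_def)
  from tight_sigma_openin[OF D this N Y[unfolded Cborel_eq] e] show thesis
    using that by (auto simp: mtopology_of_def)
qed

section \<open>Restarting and pasting solutions\<close>

lemma null_in_prob_mono:
  assumes "null_in_prob M Z" "\<And>j \<omega>. \<omega> \<in> space M \<Longrightarrow> Z' j \<omega> \<le> Z j \<omega>"
  shows "null_in_prob M Z'"
  unfolding null_in_prob_def
proof (intro allI impI)
  fix \<epsilon> :: ennreal assume "0 < \<epsilon>"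
  then have lim: "(\<lambda>j. outer_measure_of M {\<omega> \<in> space M. \<epsilon> < Z j \<omega>}) \<longlonglongrightarrow> 0"
    using assms(1) by (auto simp: null_in_prob_def)
  have "{\<omega> \<in> space M. \<epsilon> < Z' j \<omega>} \<subseteq> {\<omega> \<in> space M. \<epsilon> < Z j \<omega>}" for j
    using assms(2) by (auto intro: order_less_le_trans)
  then show "(\<lambda>j. outer_measure_of M {\<omega> \<in> space M. \<epsilon> < Z' j \<omega>}) \<longlonglongrightarrow> 0"
    by (intro tendsto_sandwich[OF _ _ tendsto_const lim] always_eventually allI outer_measure_of_mono) auto
qed

text \<open>The events inside \<open>null_in_prob\<close> are not known to be measurable; measurable
  hulls that attain the outer measure reduce subadditivity to that of
  \<open>emeasure\<close>.\<close>

lemma outer_measure_of_Un_le: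
  assumes "A \<subseteq> space M" "B \<subseteq> space M"
  shows "outer_measure_of M (A \<union> B) \<le> outer_measure_of M A + outer_measure_of M B"
proof -
  obtain E where E: "E \<in> sets M" "A \<subseteq> E" "outer_measure_of M A = emeasure M E"
    using outer_measure_of_attain[OF assms(1)] by blast
  obtain E' where E': "E' \<in> sets M" "B \<subseteq> E'" "outer_measure_of M B = emeasure M E'"
    using outer_measure_of_attain[OF assms(2)] by blast
  have "outer_measure_of M (A \<union> B) \<le> outer_measure_of M (E \<union> E')"
    using E E' by (intro outer_measure_of_mono) auto
  also have "\<dots> \<le> emeasure M E + emeasure M E'"
    using E E' by (simp add: emeasure_subadditive)
  finally show ?thesis using E E' by simp
qed

lemma null_in_prob_add:
  assumes "null_in_prob M Z1" "null_in_prob M Z2"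
  shows "null_in_prob M (\<lambda>j \<omega>. Z1 j \<omega> + Z2 j \<omega>)"
  unfolding null_in_prob_def
proof (intro allI impI)
  fix \<epsilon> :: ennreal assume \<epsilon>: "0 < \<epsilon>"
  show "(\<lambda>j. outer_measure_of M {\<omega> \<in> space M. \<epsilon> < Z1 j \<omega> + Z2 j \<omega>}) \<longlonglongrightarrow> 0"
  proof (cases \<epsilon>)
    case (real r)
    \<comment> \<open>A sum above \<open>\<epsilon>\<close> forces one summand above half of it. For
      infinite \<open>\<epsilon>\<close> the event is empty.\<close>
    define \<delta> where "\<delta> = ennreal (r / 2)"
    have \<delta>: "0 < \<delta>" "\<delta> + \<delta> = \<epsilon>"
      using \<epsilon> real by (auto simp: \<delta>_def simp flip: ennreal_plus)
    have "(\<lambda>j. outer_measure_of M {\<omega> \<in> space M. \<delta> < Z1 j \<omega>} + outer_measure_of M {\<omega> \<in> space M. \<delta> < Z2 j \<omega>})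
        \<longlonglongrightarrow> 0 + 0"
      using assms \<delta>(1) by (intro tendsto_add) (auto simp: null_in_prob_def)
    then have lim: "(\<lambda>j. outer_measure_of M {\<omega> \<in> space M. \<delta> < Z1 j \<omega>} + outer_measure_of M {\<omega> \<in> space M. \<delta> < Z2 j \<omega>})
        \<longlonglongrightarrow> 0" by simp
    have "{\<omega> \<in> space M. \<epsilon> < Z1 j \<omega> + Z2 j \<omega>} \<subseteq> {\<omega> \<in> space M. \<delta> < Z1 j \<omega>} \<union> {\<omega> \<in> space M. \<delta> < Z2 j \<omega>}" for j
      using add_mono[of "Z1 j _" \<delta> "Z2 j _" \<delta>] \<delta>(2) by (auto simp: not_less[symmetric])
    then have "outer_measure_of M {\<omega> \<in> space M. \<epsilon> < Z1 j \<omega> + Z2 j \<omega>}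
        \<le> outer_measure_of M {\<omega> \<in> space M. \<delta> < Z1 j \<omega>} + outer_measure_of M {\<omega> \<in> space M. \<delta> < Z2 j \<omega>}" for j
      by (intro order_trans[OF outer_measure_of_mono outer_measure_of_Un_le]) auto
    then show ?thesis
      by (intro tendsto_sandwich[OF _ _ tendsto_const lim] always_eventually allI) auto
  next
    case top
    then show ?thesis by simp
  qed
qed

text \<open>Two step processes are added by listing the intervals of the second after those of the
  first; this splits the resulting sums.\<close>

lemma sum_lessThan_append:
  fixes a b :: "nat \<Rightarrow> 'a::comm_monoid_add"
  shows "(\<Sum>i<n + k. if i < n then a i else b (i - n)) = (\<Sum>i<n. a i) + (\<Sum>i<k. b i)"
  by (induction k) (auto simp: add.assoc)

section \<open>Ito integrals under pasting and restarting\<close>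

lemma usual_filtration_subalgebra:
  assumes "usual_filtration M F" "0 \<le> s"
  shows "subalgebra M (F s)"
  using conjunct1[OF assms(1)[unfolded usual_filtration_def]] assms(2) by simp

lemma usual_filtration_mono:
  assumes "usual_filtration M F" "0 \<le> s" "s \<le> t"
  shows "subalgebra (F t) (F s)"
proof -
  have "sets (F s) \<subseteq> sets (F t)"
    using conjunct1[OF conjunct2[OF assms(1)[unfolded usual_filtration_def]]] assms(2,3) by simp
  moreover have "space (F s) = space M" "space (F t) = space M"
    using usual_filtration_subalgebra[OF assms(1)] assms(2,3) by (auto simp: subalgebra_def)
  ultimately show ?thesis by (simp add: subalgebra_def)
qed

text \<open>Locality of the Ito integral. Approximants of \<open>G1\<close> are cut off to
  \<open>A\<close>, those of \<open>G2\<close> to its complement; as \<open>A\<close> is known at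
  time \<open>s\<close>, before any step begins, they stay adapted. Pathwise the concatenated step
  process is exactly one of the two, and so is its integral.\<close>

lemma ito_integral_If:
  fixes G1 :: "real \<Rightarrow> 'w \<Rightarrow> real ^ 'm ^ 'd"
  assumes filt: "usual_filtration M F" and s: "0 \<le> s" and A: "A \<in> sets (F s)"
    and 1: "ito_integral M F W s G1 I1" and 2: "ito_integral M F W s G2 I2"
  shows "ito_integral M F W s (\<lambda>r \<omega>. if \<omega> \<in> A then G1 r \<omega> else G2 r \<omega>)
    (\<lambda>r \<omega>. if \<omega> \<in> A then I1 r \<omega> else I2 r \<omega>)"
proof -
  have AF: "A \<inter> space (F r) \<in> sets (F r)" if "s \<le> r" for r
    using A usual_filtration_mono[OF filt s that] by (auto simp: subalgebra_def)
  have AM: "A \<in> sets M"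
    using A usual_filtration_subalgebra[OF filt s] by (auto simp: subalgebra_def)
  let ?R = "restrict_space borel {s..} \<Otimes>\<^sub>M M"
  have "(\<lambda>z. if snd z \<in> A then (\<lambda>(r, \<omega>). G1 r \<omega>) z else (\<lambda>(r, \<omega>). G2 r \<omega>) z) \<in> borel_measurable ?R"
  proof (rule measurable_If)
    have "snd -` A \<inter> space ?R \<in> sets ?R" using AM by (rule measurable_sets[OF measurable_snd])
    then show "{z \<in> space ?R. snd z \<in> A} \<in> sets ?R" by (simp add: vimage_def Int_def conj_commute)
  qed (use 1 2 in \<open>auto simp: ito_integral_def\<close>)
  moreover have "(\<lambda>z. if snd z \<in> A then (\<lambda>(r, \<omega>). G1 r \<omega>) z else (\<lambda>(r, \<omega>). G2 r \<omega>) z)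
      = (\<lambda>(r, \<omega>). if \<omega> \<in> A then G1 r \<omega> else G2 r \<omega>)" by auto
  ultimately have G_meas: "(\<lambda>(r, \<omega>). if \<omega> \<in> A then G1 r \<omega> else G2 r \<omega>) \<in> borel_measurable ?R" by simp
  obtain n1 u1 v1 \<phi>1 where a1: "\<And>j. step_process M F s (n1 j) (u1 j) (v1 j) (\<phi>1 j)"
    and b1: "\<And>T. s \<le> T \<Longrightarrow> null_in_prob M (\<lambda>j \<omega>. \<integral>\<^sup>+ r\<in>{s..T}.
             ennreal ((norm (step_value (n1 j) (u1 j) (v1 j) (\<phi>1 j) r \<omega> - G1 r \<omega>))\<^sup>2) \<partial>lborel)"
    and c1: "\<And>T. s \<le> T \<Longrightarrow> null_in_prob M (\<lambda>j \<omega>. SUP r\<in>{s..T}.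
             ennreal (norm (step_integral W (n1 j) (u1 j) (v1 j) (\<phi>1 j) r \<omega> - I1 r \<omega>)))"
    using 1 unfolding ito_integral_def by blast
  obtain n2 u2 v2 \<phi>2 where a2: "\<And>j. step_process M F s (n2 j) (u2 j) (v2 j) (\<phi>2 j)"
    and b2: "\<And>T. s \<le> T \<Longrightarrow> null_in_prob M (\<lambda>j \<omega>. \<integral>\<^sup>+ r\<in>{s..T}.
             ennreal ((norm (step_value (n2 j) (u2 j) (v2 j) (\<phi>2 j) r \<omega> - G2 r \<omega>))\<^sup>2) \<partial>lborel)"
    and c2: "\<And>T. s \<le> T \<Longrightarrow> null_in_prob M (\<lambda>j \<omega>. SUP r\<in>{s..T}.
             ennreal (norm (step_integral W (n2 j) (u2 j) (v2 j) (\<phi>2 j) r \<omega> - I2 r \<omega>)))"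
    using 2 unfolding ito_integral_def by blast
  define u where "u j i = (if i < n1 j then u1 j i else u2 j (i - n1 j))" for j i
  define v where "v j i = (if i < n1 j then v1 j i else v2 j (i - n1 j))" for j i
  define \<phi> where "\<phi> j i \<omega> = (if i < n1 j then (if \<omega> \<in> A then \<phi>1 j i \<omega> else 0)
      else (if \<omega> \<in> A then 0 else \<phi>2 j (i - n1 j) \<omega>))" for j i \<omega>
  have step: "step_process M F s (n1 j + n2 j) (u j) (v j) (\<phi> j)" for j
    unfolding step_process_def
  proof (intro allI impI)
    fix i assume i: "i < n1 j + n2 j"
    show "s \<le> u j i \<and> u j i \<le> v j i \<and> \<phi> j i \<in> borel_measurable (F (u j i))
        \<and> (\<exists>B. \<forall>\<omega>\<in>space M. norm (\<phi> j i \<omega>) \<le> B)"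
    proof (cases "i < n1 j")
      case True
      then obtain B where B: "s \<le> u1 j i" "u1 j i \<le> v1 j i" "\<phi>1 j i \<in> borel_measurable (F (u1 j i))"
          "\<forall>\<omega>\<in>space M. norm (\<phi>1 j i \<omega>) \<le> B"
        using a1[of j] unfolding step_process_def by blast
      have "(\<lambda>\<omega>. if \<omega> \<in> A then \<phi>1 j i \<omega> else 0) \<in> borel_measurable (F (u1 j i))"
        using B AF by (intro measurable_If_set) auto
      moreover have "\<exists>B. \<forall>\<omega>\<in>space M. norm (\<phi> j i \<omega>) \<le> B"
        using B(4) True by (intro exI[of _ "max B 0"]) (auto simp: \<phi>_def le_max_iff_disj)
      moreover have "\<phi> j i = (\<lambda>\<omega>. if \<omega> \<in> A then \<phi>1 j i \<omega> else 0)"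
        using True by (auto simp: \<phi>_def)
      ultimately show ?thesis using True B by (simp only: u_def v_def if_True simp_thms)
    next
      case False
      then have "i - n1 j < n2 j" using i by simp
      then obtain B where B: "s \<le> u2 j (i - n1 j)" "u2 j (i - n1 j) \<le> v2 j (i - n1 j)"
          "\<phi>2 j (i - n1 j) \<in> borel_measurable (F (u2 j (i - n1 j)))"
          "\<forall>\<omega>\<in>space M. norm (\<phi>2 j (i - n1 j) \<omega>) \<le> B"
        using a2[of j] unfolding step_process_def by blast
      have "(\<lambda>\<omega>. if \<omega> \<in> A then 0 else \<phi>2 j (i - n1 j) \<omega>) \<in> borel_measurable (F (u2 j (i - n1 j)))"
        using B AF by (intro measurable_If_set) auto
      moreover have "\<exists>B. \<forall>\<omega>\<in>space M. norm (\<phi> j i \<omega>) \<le> B"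
        using B(4) False by (intro exI[of _ "max B 0"]) (auto simp: \<phi>_def le_max_iff_disj)
      moreover have "\<phi> j i = (\<lambda>\<omega>. if \<omega> \<in> A then 0 else \<phi>2 j (i - n1 j) \<omega>)"
        using False by (auto simp: \<phi>_def)
      ultimately show ?thesis using False B by (simp only: u_def v_def if_False simp_thms)
    qed
  qed
  have val_eq: "step_value (n1 j + n2 j) (u j) (v j) (\<phi> j) r \<omega>
      = (if \<omega> \<in> A then step_value (n1 j) (u1 j) (v1 j) (\<phi>1 j) r \<omega>
         else step_value (n2 j) (u2 j) (v2 j) (\<phi>2 j) r \<omega>)" for j r \<omega>
  proof -
    have "step_value (n1 j + n2 j) (u j) (v j) (\<phi> j) r \<omega> = (\<Sum>i<n1 j + n2 j. if i < n1 j
        then indicator {u1 j i<..v1 j i} r *\<^sub>R (if \<omega> \<in> A then \<phi>1 j i \<omega> else 0)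
        else indicator {u2 j (i - n1 j)<..v2 j (i - n1 j)} r *\<^sub>R (if \<omega> \<in> A then 0 else \<phi>2 j (i - n1 j) \<omega>))"
      unfolding step_value_def by (intro sum.cong) (auto simp: u_def v_def \<phi>_def)
    then show ?thesis by (simp add: sum_lessThan_append[where b="\<lambda>i. indicator {u2 j i<..v2 j i} r *\<^sub>R (if \<omega> \<in> A then 0 else \<phi>2 j i \<omega>)"] step_value_def)
  qed
  have integral: "step_integral W (n1 j + n2 j) (u j) (v j) (\<phi> j) r \<omega>
      = (if \<omega> \<in> A then step_integral W (n1 j) (u1 j) (v1 j) (\<phi>1 j) r \<omega>
         else step_integral W (n2 j) (u2 j) (v2 j) (\<phi>2 j) r \<omega>)" for j r \<omega>
  proof -
    have "step_integral W (n1 j + n2 j) (u j) (v j) (\<phi> j) r \<omega> = (\<Sum>i<n1 j + n2 j. if i < n1 j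
        then (if \<omega> \<in> A then \<phi>1 j i \<omega> else 0) *v (W (min r (v1 j i)) \<omega> - W (min r (u1 j i)) \<omega>)
        else (if \<omega> \<in> A then 0 else \<phi>2 j (i - n1 j) \<omega>)
          *v (W (min r (v2 j (i - n1 j))) \<omega> - W (min r (u2 j (i - n1 j))) \<omega>))"
      unfolding step_integral_def by (intro sum.cong) (auto simp: u_def v_def \<phi>_def)
    then show ?thesis by (simp add: sum_lessThan_append[where
        b="\<lambda>i. (if \<omega> \<in> A then 0 else \<phi>2 j i \<omega>) *v (W (min r (v2 j i)) \<omega> - W (min r (u2 j i)) \<omega>)"] step_integral_def)
  qed
  \<comment> \<open>For each \<open>\<omega>\<close> the new error equals the old error for
    \<open>G1\<close> or the one for \<open>G2\<close>, and the sum of both dominates it in either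
    case.\<close>
  have b: "null_in_prob M (\<lambda>j \<omega>. \<integral>\<^sup>+ r\<in>{s..T}. ennreal ((norm (step_value (n1 j + n2 j) (u j) (v j) (\<phi> j) r \<omega>
      - (if \<omega> \<in> A then G1 r \<omega> else G2 r \<omega>)))\<^sup>2) \<partial>lborel)" if "s \<le> T" for T
    apply (rule null_in_prob_mono[OF null_in_prob_add[OF b1[OF that] b2[OF that]]])
    subgoal for j \<omega> by (cases "\<omega> \<in> A") (simp_all add: val_eq)
    done
  have c: "null_in_prob M (\<lambda>j \<omega>. SUP r\<in>{s..T}. ennreal (norm (step_integral W (n1 j + n2 j) (u j) (v j) (\<phi> j) r \<omega>
      - (if \<omega> \<in> A then I1 r \<omega> else I2 r \<omega>))))" if "s \<le> T" for T
    apply (rule null_in_prob_mono[OF null_in_prob_add[OF c1[OF that] c2[OF that]]])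
    subgoal for j \<omega> by (cases "\<omega> \<in> A") (simp_all add: integral)
    done
  have "\<exists>n u v \<phi>. (\<forall>j. step_process M F s (n j) (u j) (v j) (\<phi> j)) \<and>
        (\<forall>T\<ge>s. null_in_prob M (\<lambda>j \<omega>. \<integral>\<^sup>+ r\<in>{s..T}. ennreal ((norm (step_value (n j) (u j) (v j) (\<phi> j) r \<omega>
                   - (if \<omega> \<in> A then G1 r \<omega> else G2 r \<omega>)))\<^sup>2) \<partial>lborel) \<and>
           null_in_prob M (\<lambda>j \<omega>. SUP r\<in>{s..T}. ennreal (norm (step_integral W (n j) (u j) (v j) (\<phi> j) r \<omega>
                   - (if \<omega> \<in> A then I1 r \<omega> else I2 r \<omega>)))))"
    using step b c by (intro exI[of _ "\<lambda>j. n1 j + n2 j"] exI[of _ u] exI[of _ v] exI[of _ \<phi>]) blast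
  moreover have "AE \<omega> in M. \<forall>T\<ge>s. (\<integral>\<^sup>+ r\<in>{s..T}.
      ennreal ((norm (if \<omega> \<in> A then G1 r \<omega> else G2 r \<omega>))\<^sup>2) \<partial>lborel) < \<infinity>"
  proof -
    have "AE \<omega> in M. \<forall>T\<ge>s. (\<integral>\<^sup>+ r\<in>{s..T}. ennreal ((norm (G1 r \<omega>))\<^sup>2) \<partial>lborel) < \<infinity>"
      "AE \<omega> in M. \<forall>T\<ge>s. (\<integral>\<^sup>+ r\<in>{s..T}. ennreal ((norm (G2 r \<omega>))\<^sup>2) \<partial>lborel) < \<infinity>"
      using 1 2 unfolding ito_integral_def by blast+
    then show ?thesis 
  proof eventually_elim
    case (elim \<omega>)
    then show ?case by (cases "\<omega> \<in> A") simp_all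
  qed
  qed
  moreover have "\<forall>r\<ge>s. (\<lambda>\<omega>. if \<omega> \<in> A then G1 r \<omega> else G2 r \<omega>) \<in> borel_measurable (F r)"
    "\<forall>r\<ge>s. (\<lambda>\<omega>. if \<omega> \<in> A then I1 r \<omega> else I2 r \<omega>) \<in> borel_measurable (F r)"
    using 1 2 AF unfolding ito_integral_def by (auto intro!: measurable_If_set)
  moreover have "continuous_on {s..} (\<lambda>r. if \<omega> \<in> A then I1 r \<omega> else I2 r \<omega>)" if "\<omega> \<in> space M" for \<omega>
    using 1 2 that unfolding ito_integral_def by (cases "\<omega> \<in> A") simp_all
  then have "\<forall>\<omega>\<in>space M. continuous_on {s..} (\<lambda>r. if \<omega> \<in> A then I1 r \<omega> else I2 r \<omega>)" by blast
  ultimately show ?thesis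
    unfolding ito_integral_def using G_meas by blast
qed

text \<open>Clipping all interval ends by \<open>max s\<close> leaves the step values after
  \<open>s\<close> unchanged and turns the step integral into its increment since \<open>s\<close>.
  Measurability survives because clipping can only delay the start of a step.\<close>

lemma ito_integral_restart:
  fixes G :: "real \<Rightarrow> 'w \<Rightarrow> real ^ 'm ^ 'd"
  assumes filt: "usual_filtration M F" and s0: "0 \<le> s\<^sub>0" and s: "s\<^sub>0 \<le> s"
    and I: "ito_integral M F W s\<^sub>0 G I"
  shows "ito_integral M F W s G (\<lambda>t \<omega>. I t \<omega> - I s \<omega>)"
proof -
  obtain n u v \<phi> where a: "\<And>j. step_process M F s\<^sub>0 (n j) (u j) (v j) (\<phi> j)"
    and b: "\<And>T. s\<^sub>0 \<le> T \<Longrightarrow> null_in_prob M (\<lambda>j \<omega>. \<integral>\<^sup>+ r\<in>{s\<^sub>0..T}.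
             ennreal ((norm (step_value (n j) (u j) (v j) (\<phi> j) r \<omega> - G r \<omega>))\<^sup>2) \<partial>lborel)"
    and c: "\<And>T. s\<^sub>0 \<le> T \<Longrightarrow> null_in_prob M (\<lambda>j \<omega>. SUP r\<in>{s\<^sub>0..T}.
             ennreal (norm (step_integral W (n j) (u j) (v j) (\<phi> j) r \<omega> - I r \<omega>)))"
    using I unfolding ito_integral_def by blast
  define u' where "u' j i = max s (u j i)" for j i
  define v' where "v' j i = max s (v j i)" for j i
  have step: "step_process M F s (n j) (u' j) (v' j) (\<phi> j)" for j
    unfolding step_process_def
  proof (intro allI impI)
    fix i assume "i < n j"
    then have *: "s\<^sub>0 \<le> u j i" "u j i \<le> v j i" "\<phi> j i \<in> borel_measurable (F (u j i))"
        "\<exists>B. \<forall>\<omega>\<in>space M. norm (\<phi> j i \<omega>) \<le> B"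
      using a[of j] unfolding step_process_def by blast+
    have "\<phi> j i \<in> borel_measurable (F (u' j i))"
      by (rule measurable_from_subalg[OF usual_filtration_mono[OF filt _ _] *(3)]) (use * s0 in \<open>auto simp: u'_def\<close>)
    with * show "s \<le> u' j i \<and> u' j i \<le> v' j i \<and> \<phi> j i \<in> borel_measurable (F (u' j i))
        \<and> (\<exists>B. \<forall>\<omega>\<in>space M. norm (\<phi> j i \<omega>) \<le> B)"
      by (auto simp: u'_def v'_def)
  qed
  have val_eq: "step_value (n j) (u' j) (v' j) (\<phi> j) r \<omega> = step_value (n j) (u j) (v j) (\<phi> j) r \<omega>"
    if "s < r" for j r \<omega>
    unfolding step_value_def using that by (intro sum.cong) (auto simp: u'_def v'_def indicator_def)
  have integral: "step_integral W (n j) (u' j) (v' j) (\<phi> j) r \<omega>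
      = step_integral W (n j) (u j) (v j) (\<phi> j) r \<omega> - step_integral W (n j) (u j) (v j) (\<phi> j) s \<omega>"
    if r: "s \<le> r" for j r \<omega>
  proof -
    have "W (min r (v' j i)) \<omega> - W (min r (u' j i)) \<omega>
        = (W (min r (v j i)) \<omega> - W (min r (u j i)) \<omega>) - (W (min s (v j i)) \<omega> - W (min s (u j i)) \<omega>)"
      if "u j i \<le> v j i" for i
      using that r unfolding u'_def v'_def max_def min_def by (auto simp: not_le dest: order_antisym)
    then show ?thesis
      using a[of j] unfolding step_integral_def step_process_def sum_subtractf[symmetric]
      by (intro sum.cong) (auto simp: matrix_vector_mult_diff_distrib)
  qed
  have b': "null_in_prob M (\<lambda>j \<omega>. \<integral>\<^sup>+ r\<in>{s..T}.
      ennreal ((norm (step_value (n j) (u' j) (v' j) (\<phi> j) r \<omega> - G r \<omega>))\<^sup>2) \<partial>lborel)" if "s \<le> T" for T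
  proof (rule null_in_prob_mono[OF b])
    fix j \<omega>
    \<comment> \<open>The clipped half-open intervals never contain \<open>s\<close>, so the two
      step processes may differ at this point, which has Lebesgue measure zero.\<close>
    have "AE r in lborel. r \<noteq> s" by (rule AE_lborel_singleton)
    then have "AE r in lborel.
        ennreal ((norm (step_value (n j) (u' j) (v' j) (\<phi> j) r \<omega> - G r \<omega>))\<^sup>2) * indicator {s..T} r
      \<le> ennreal ((norm (step_value (n j) (u j) (v j) (\<phi> j) r \<omega> - G r \<omega>))\<^sup>2) * indicator {s\<^sub>0..T} r"
      by eventually_elim (use s in \<open>auto simp: val_eq indicator_def\<close>)
    then show "(\<integral>\<^sup>+ r\<in>{s..T}. ennreal ((norm (step_value (n j) (u' j) (v' j) (\<phi> j) r \<omega> - G r \<omega>))\<^sup>2) \<partial>lborel)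
      \<le> (\<integral>\<^sup>+ r\<in>{s\<^sub>0..T}. ennreal ((norm (step_value (n j) (u j) (v j) (\<phi> j) r \<omega> - G r \<omega>))\<^sup>2) \<partial>lborel)"
      by (rule nn_integral_mono_AE)
  qed (use that s in auto)
  have c': "null_in_prob M (\<lambda>j \<omega>. SUP r\<in>{s..T}.
      ennreal (norm (step_integral W (n j) (u' j) (v' j) (\<phi> j) r \<omega> - (I r \<omega> - I s \<omega>))))" if T: "s \<le> T" for T
  \<comment> \<open>The error of an increment is at most the error at \<open>r\<close> plus the
    error at \<open>s\<close>, hence the same supremum is taken twice.\<close>
  proof (rule null_in_prob_mono[OF null_in_prob_add[OF c c]])
    fix j \<omega>
    let ?E = "\<lambda>r. norm (step_integral W (n j) (u j) (v j) (\<phi> j) r \<omega> - I r \<omega>)"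
    show "(SUP r\<in>{s..T}. ennreal (norm (step_integral W (n j) (u' j) (v' j) (\<phi> j) r \<omega> - (I r \<omega> - I s \<omega>))))
        \<le> (SUP r\<in>{s\<^sub>0..T}. ennreal (?E r)) + (SUP r\<in>{s\<^sub>0..T}. ennreal (?E r))"
    proof (rule SUP_least)
      fix r assume r: "r \<in> {s..T}"
      have "norm (step_integral W (n j) (u' j) (v' j) (\<phi> j) r \<omega> - (I r \<omega> - I s \<omega>))
          = norm ((step_integral W (n j) (u j) (v j) (\<phi> j) r \<omega> - I r \<omega>)
              - (step_integral W (n j) (u j) (v j) (\<phi> j) s \<omega> - I s \<omega>))"
        using r by (simp add: integral algebra_simps)
      also have "\<dots> \<le> ?E r + ?E s" by (rule norm_triangle_ineq4)
      finally have "ennreal (norm (step_integral W (n j) (u' j) (v' j) (\<phi> j) r \<omega> - (I r \<omega> - I s \<omega>)))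
          \<le> ennreal (?E r) + ennreal (?E s)"
        by (simp add: ennreal_leI flip: ennreal_plus)
      also have "\<dots> \<le> (SUP r\<in>{s\<^sub>0..T}. ennreal (?E r)) + (SUP r\<in>{s\<^sub>0..T}. ennreal (?E r))"
        using r s T by (intro add_mono SUP_upper) auto
      finally show "ennreal (norm (step_integral W (n j) (u' j) (v' j) (\<phi> j) r \<omega> - (I r \<omega> - I s \<omega>)))
          \<le> (SUP r\<in>{s\<^sub>0..T}. ennreal (?E r)) + (SUP r\<in>{s\<^sub>0..T}. ennreal (?E r))" .
    qed
  qed (use T s in auto)
  have "\<exists>n u v \<phi>. (\<forall>j. step_process M F s (n j) (u j) (v j) (\<phi> j)) \<and>
        (\<forall>T\<ge>s. null_in_prob M (\<lambda>j \<omega>. \<integral>\<^sup>+ r\<in>{s..T}.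
             ennreal ((norm (step_value (n j) (u j) (v j) (\<phi> j) r \<omega> - G r \<omega>))\<^sup>2) \<partial>lborel) \<and>
           null_in_prob M (\<lambda>j \<omega>. SUP r\<in>{s..T}.
             ennreal (norm (step_integral W (n j) (u j) (v j) (\<phi> j) r \<omega> - (I r \<omega> - I s \<omega>)))))"
    using step b' c' by (intro exI[of _ n] exI[of _ u'] exI[of _ v'] exI[of _ \<phi>]) blast
  moreover have "(\<lambda>(r, \<omega>). G r \<omega>) \<in> borel_measurable (restrict_space borel {s..} \<Otimes>\<^sub>M M)"
  proof -
    let ?R = "restrict_space borel {s..} \<Otimes>\<^sub>M M"
    have "fst \<in> ?R \<rightarrow>\<^sub>M borel"
      by (rule measurable_compose[OF measurable_fst]) (rule measurable_restrict_space1, simp)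
    moreover have "fst \<in> space ?R \<rightarrow> {s\<^sub>0..}"
      using s by (auto simp: space_pair_measure space_restrict_space)
    ultimately have "fst \<in> ?R \<rightarrow>\<^sub>M restrict_space borel {s\<^sub>0..}"
      by (intro measurable_restrict_space2) 
    then have "(\<lambda>z. (fst z, snd z)) \<in> ?R \<rightarrow>\<^sub>M restrict_space borel {s\<^sub>0..} \<Otimes>\<^sub>M M"
      by (rule measurable_Pair[OF _ measurable_snd])
    moreover have "(\<lambda>(r, \<omega>). G r \<omega>) \<in> borel_measurable (restrict_space borel {s\<^sub>0..} \<Otimes>\<^sub>M M)"
      using I unfolding ito_integral_def by (rule conjunct1)
    ultimately have "(\<lambda>z. (\<lambda>(r, \<omega>). G r \<omega>) (fst z, snd z)) \<in> borel_measurable ?R"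
      by (rule measurable_compose)
    then show ?thesis by simp
  qed
  moreover have "AE \<omega> in M. \<forall>T\<ge>s. (\<integral>\<^sup>+ r\<in>{s..T}. ennreal ((norm (G r \<omega>))\<^sup>2) \<partial>lborel) < \<infinity>"
  proof -
    have "AE \<omega> in M. \<forall>T\<ge>s\<^sub>0. (\<integral>\<^sup>+ r\<in>{s\<^sub>0..T}. ennreal ((norm (G r \<omega>))\<^sup>2) \<partial>lborel) < \<infinity>"
      using I unfolding ito_integral_def by blast
    then show ?thesis
    proof eventually_elim
      case (elim \<omega>)
      show ?case
      proof (intro allI impI)
        fix T assume "s \<le> T"
        then have "(\<integral>\<^sup>+ r\<in>{s\<^sub>0..T}. ennreal ((norm (G r \<omega>))\<^sup>2) \<partial>lborel) < \<infinity>" using elim s by auto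
        moreover have "(\<integral>\<^sup>+ r\<in>{s..T}. ennreal ((norm (G r \<omega>))\<^sup>2) \<partial>lborel)
            \<le> (\<integral>\<^sup>+ r\<in>{s\<^sub>0..T}. ennreal ((norm (G r \<omega>))\<^sup>2) \<partial>lborel)"
          using s by (intro nn_set_integral_set_mono) auto
        ultimately show "(\<integral>\<^sup>+ r\<in>{s..T}. ennreal ((norm (G r \<omega>))\<^sup>2) \<partial>lborel) < \<infinity>"
          by (rule le_less_trans[rotated])
      qed
    qed
  qed
  moreover have "\<forall>r\<ge>s. G r \<in> borel_measurable (F r)"
    using I s unfolding ito_integral_def by auto
  moreover have "\<forall>r\<ge>s. (\<lambda>\<omega>. I r \<omega> - I s \<omega>) \<in> borel_measurable (F r)"
  proof (intro allI impI borel_measurable_diff)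
    fix r assume r: "s \<le> r"
    show "I s \<in> borel_measurable (F r)"
      using I s s0 r unfolding ito_integral_def
      by (intro measurable_from_subalg[OF usual_filtration_mono[OF filt _ r]]) auto
    show "I r \<in> borel_measurable (F r)"
      using I s r unfolding ito_integral_def by auto
  qed
  moreover have "\<forall>\<omega>\<in>space M. continuous_on {s..} (\<lambda>r. I r \<omega> - I s \<omega>)"
    using I s unfolding ito_integral_def
    by (auto intro!: continuous_intros intro: continuous_on_subset)
  ultimately show ?thesis unfolding ito_integral_def by blast
qed

text \<open>The coefficients are evaluated path by path, so drift and initial segment can be treated
  for each \<open>\<omega>\<close> separately; only the noise term relies on the locality of the Ito
  integral.\<close>

lemma sdde_solution_If:
  assumes filt: "usual_filtration M F" and s: "0 \<le> s" and A: "A \<in> sets (F s)"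
    and 1: "sdde_solution M F W \<tau> f g s \<eta>1 y1" and 2: "sdde_solution M F W \<tau> f g s \<eta>2 y2"
  shows "sdde_solution M F W \<tau> f g s (\<lambda>\<omega>. if \<omega> \<in> A then \<eta>1 \<omega> else \<eta>2 \<omega>)
    (\<lambda>t \<omega>. if \<omega> \<in> A then y1 t \<omega> else y2 t \<omega>)"
proof -
  have AF: "A \<inter> space (F r) \<in> sets (F r)" if "s \<le> r" for r
    using A usual_filtration_mono[OF filt s that] by (auto simp: subalgebra_def)
  let ?y = "\<lambda>t \<omega>. if \<omega> \<in> A then y1 t \<omega> else y2 t \<omega>"
  obtain I1 where I1: "ito_integral M F W s (\<lambda>r \<omega>. g (y1 r \<omega>, y1 (r - \<tau>) \<omega>)) I1"
      "AE \<omega> in M. \<forall>t\<ge>s. y1 t \<omega> = \<eta>1 \<omega> 0 + (LINT r:{s..t}|lborel. f (y1 r \<omega>, y1 (r - \<tau>) \<omega>)) + I1 t \<omega>"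
    using 1 unfolding sdde_solution_def by blast
  obtain I2 where I2: "ito_integral M F W s (\<lambda>r \<omega>. g (y2 r \<omega>, y2 (r - \<tau>) \<omega>)) I2"
      "AE \<omega> in M. \<forall>t\<ge>s. y2 t \<omega> = \<eta>2 \<omega> 0 + (LINT r:{s..t}|lborel. f (y2 r \<omega>, y2 (r - \<tau>) \<omega>)) + I2 t \<omega>"
    using 2 unfolding sdde_solution_def by blast
  let ?I = "\<lambda>r \<omega>. if \<omega> \<in> A then I1 r \<omega> else I2 r \<omega>"
  have "(\<lambda>r \<omega>. g (?y r \<omega>, ?y (r - \<tau>) \<omega>))
      = (\<lambda>r \<omega>. if \<omega> \<in> A then g (y1 r \<omega>, y1 (r - \<tau>) \<omega>) else g (y2 r \<omega>, y2 (r - \<tau>) \<omega>))" by (intro ext) simp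
  then have "ito_integral M F W s (\<lambda>r \<omega>. g (?y r \<omega>, ?y (r - \<tau>) \<omega>)) ?I"
    using ito_integral_If[OF filt s A I1(1) I2(1)] by simp
  moreover have "AE \<omega> in M. \<forall>t\<ge>s. ?y t \<omega> = (if \<omega> \<in> A then \<eta>1 \<omega> else \<eta>2 \<omega>) 0
      + (LINT r:{s..t}|lborel. f (?y r \<omega>, ?y (r - \<tau>) \<omega>)) + ?I t \<omega>"
    using I1(2) I2(2) 
  proof eventually_elim
    case (elim \<omega>)
    then show ?case by (cases "\<omega> \<in> A") simp_all
  qed
  moreover have "AE \<omega> in M. \<forall>t\<ge>s. set_integrable lborel {s..t} (\<lambda>r. f (?y r \<omega>, ?y (r - \<tau>) \<omega>))"
  proof -
    have "AE \<omega> in M. \<forall>t\<ge>s. set_integrable lborel {s..t} (\<lambda>r. f (y1 r \<omega>, y1 (r - \<tau>) \<omega>))"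
      "AE \<omega> in M. \<forall>t\<ge>s. set_integrable lborel {s..t} (\<lambda>r. f (y2 r \<omega>, y2 (r - \<tau>) \<omega>))"
      using 1 2 unfolding sdde_solution_def by blast+
    then show ?thesis 
  proof eventually_elim
    case (elim \<omega>)
    then show ?case by (cases "\<omega> \<in> A") simp_all
  qed
  qed
  moreover have "\<forall>t\<ge>s. ?y t \<in> borel_measurable (F t)"
    using 1 2 AF unfolding sdde_solution_def by (auto intro!: measurable_If_set)
  moreover have "continuous_on {s - \<tau>..} (\<lambda>t. ?y t \<omega>)" if "\<omega> \<in> space M" for \<omega>
    using 1 2 that unfolding sdde_solution_def by (cases "\<omega> \<in> A") simp_all
  then have "\<forall>\<omega>\<in>space M. continuous_on {s - \<tau>..} (\<lambda>t. ?y t \<omega>)" by blast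
  moreover have "\<forall>\<omega>\<in>space M. \<forall>\<theta>\<in>{-\<tau>..0}. ?y (s + \<theta>) \<omega> = (if \<omega> \<in> A then \<eta>1 \<omega> else \<eta>2 \<omega>) \<theta>"
    using 1 2 unfolding sdde_solution_def by simp
  ultimately show ?thesis unfolding sdde_solution_def by blast
qed

text \<open>Subtracting the equation at \<open>s\<close> from the one at \<open>t\<close> replaces
  the initial value by \<open>y s \<omega>\<close> and both integrals by their increments.\<close>

lemma sdde_solution_restart:
  assumes filt: "usual_filtration M F" and s0: "0 \<le> s\<^sub>0" and s: "s\<^sub>0 \<le> s" and \<tau>: "0 \<le> \<tau>"
    and y: "sdde_solution M F W \<tau> f g s\<^sub>0 \<eta> y"
  shows "sdde_solution M F W \<tau> f g s (segment \<tau> y s) y"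
proof -
  obtain I where I: "ito_integral M F W s\<^sub>0 (\<lambda>r \<omega>. g (y r \<omega>, y (r - \<tau>) \<omega>)) I"
      "AE \<omega> in M. \<forall>t\<ge>s\<^sub>0. y t \<omega> = \<eta> \<omega> 0 + (LINT r:{s\<^sub>0..t}|lborel. f (y r \<omega>, y (r - \<tau>) \<omega>)) + I t \<omega>"
    using y unfolding sdde_solution_def by blast
  have int: "AE \<omega> in M. \<forall>t\<ge>s\<^sub>0. set_integrable lborel {s\<^sub>0..t} (\<lambda>r. f (y r \<omega>, y (r - \<tau>) \<omega>))"
    using y unfolding sdde_solution_def by blast
  note ito_integral_restart[OF filt s0 s I(1)]
  moreover have "AE \<omega> in M. \<forall>t\<ge>s. y t \<omega> = segment \<tau> y s \<omega> 0
      + (LINT r:{s..t}|lborel. f (y r \<omega>, y (r - \<tau>) \<omega>)) + (I t \<omega> - I s \<omega>)"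
    using I(2) int
  proof eventually_elim
    case (elim \<omega>)
    show ?case
    proof (intro allI impI)
      fix t assume t: "s \<le> t"
      have "set_integrable lborel {s\<^sub>0..t} (\<lambda>r. f (y r \<omega>, y (r - \<tau>) \<omega>))" using elim(2) s t by auto
      then have "set_integrable lborel {s\<^sub>0..s} (\<lambda>r. f (y r \<omega>, y (r - \<tau>) \<omega>))"
        "set_integrable lborel {s..t} (\<lambda>r. f (y r \<omega>, y (r - \<tau>) \<omega>))"
        using s t by (auto elim!: set_integrable_subset)
      \<comment> \<open>The two closed intervals share the point \<open>s\<close>, so they are
        disjoint only up to a null set.\<close>
      moreover have "AE r in lborel. \<not> (r \<in> {s\<^sub>0..s} \<and> r \<in> {s..t})"
        using AE_lborel_singleton[of s] by eventually_elim auto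
      ultimately have "(LINT r:{s\<^sub>0..s} \<union> {s..t}|lborel. f (y r \<omega>, y (r - \<tau>) \<omega>))
          = (LINT r:{s\<^sub>0..s}|lborel. f (y r \<omega>, y (r - \<tau>) \<omega>)) + (LINT r:{s..t}|lborel. f (y r \<omega>, y (r - \<tau>) \<omega>))"
        by (intro set_integral_Un_AE) auto
      moreover have "{s\<^sub>0..s} \<union> {s..t} = {s\<^sub>0..t}" using s t by auto
      moreover have "y t \<omega> = \<eta> \<omega> 0 + (LINT r:{s\<^sub>0..t}|lborel. f (y r \<omega>, y (r - \<tau>) \<omega>)) + I t \<omega>"
        "y s \<omega> = \<eta> \<omega> 0 + (LINT r:{s\<^sub>0..s}|lborel. f (y r \<omega>, y (r - \<tau>) \<omega>)) + I s \<omega>"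
        using elim(1) s t by auto
      moreover have "segment \<tau> y s \<omega> 0 = y s \<omega>" using \<tau> by (simp add: segment_def)
      ultimately show "y t \<omega> = segment \<tau> y s \<omega> 0
          + (LINT r:{s..t}|lborel. f (y r \<omega>, y (r - \<tau>) \<omega>)) + (I t \<omega> - I s \<omega>)" by (simp add: algebra_simps)
    qed
  qed
  moreover have "AE \<omega> in M. \<forall>t\<ge>s. set_integrable lborel {s..t} (\<lambda>r. f (y r \<omega>, y (r - \<tau>) \<omega>))"
    using int
  proof eventually_elim
    case (elim \<omega>)
    show ?case
    proof (intro allI impI)
      fix t assume t: "s \<le> t"
      then have "set_integrable lborel {s\<^sub>0..t} (\<lambda>r. f (y r \<omega>, y (r - \<tau>) \<omega>))"
        using elim s by simp
      then show "set_integrable lborel {s..t} (\<lambda>r. f (y r \<omega>, y (r - \<tau>) \<omega>))"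
        by (rule set_integrable_subset) (use s in auto)
    qed
  qed
  moreover have "\<forall>\<omega>\<in>space M. continuous_on {s - \<tau>..} (\<lambda>t. y t \<omega>)" "\<forall>t\<ge>s. y t \<in> borel_measurable (F t)"
    "\<forall>\<omega>\<in>space M. \<forall>\<theta>\<in>{-\<tau>..0}. y (s + \<theta>) \<omega> = segment \<tau> y s \<omega> \<theta>"
    using y s unfolding sdde_solution_def by (auto simp: segment_def intro: continuous_on_subset)
  ultimately show ?thesis unfolding sdde_solution_def by blast
qed

section \<open>Segments as random variables, flow property and locality\<close>

lemma segment_in_mspace:
  assumes "continuous_on {t - \<tau>..} (\<lambda>r. y r \<omega>)"
  shows "segment \<tau> y t \<omega> \<in> mspace (Cspace \<tau>)"
proof -
  have "continuous_on {-\<tau>..0} (\<lambda>\<theta>. y (t + \<theta>) \<omega>)"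
    by (rule continuous_on_compose2[OF assms]) (auto intro!: continuous_intros)
  then have "continuous_on {-\<tau>..0} (segment \<tau> y t \<omega>)"
    by (rule continuous_on_cong[THEN iffD1, rotated 2]) (auto simp: segment_def)
  then show ?thesis by (simp add: mspace_Cspace segment_def)
qed

text \<open>Coordinates with \<open>t + \<theta> \<ge> s\<close> are measurable by adaptedness of
  the solution; earlier ones are read off the initial segment, which is known at time
  \<open>s\<close>.\<close>

lemma segment_solution_measurable:
  fixes y :: "real \<Rightarrow> 'w \<Rightarrow> real ^ 'd"
  assumes filt: "usual_filtration M F" and \<tau>: "0 < \<tau>" and s: "0 \<le> s" and t: "s \<le> t"
    and \<eta>: "\<eta> \<in> F s \<rightarrow>\<^sub>M Cborel \<tau>" and y: "sdde_solution M F W \<tau> f g s \<eta> y"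
  shows "segment \<tau> y t \<in> F t \<rightarrow>\<^sub>M Cborel \<tau>"
proof (rule measurable_CborelI[OF \<tau>])
  have sp: "space (F t) = space M"
    using usual_filtration_subalgebra[OF filt, of t] s t by (simp add: subalgebra_def)
  show "segment \<tau> y t \<omega> \<in> mspace (Cspace \<tau>)" if "\<omega> \<in> space (F t)" for \<omega>
  proof (rule segment_in_mspace)
    have "continuous_on {s - \<tau>..} (\<lambda>t. y t \<omega>)"
      using y that sp unfolding sdde_solution_def by blast
    then show "continuous_on {t - \<tau>..} (\<lambda>t. y t \<omega>)"
      by (rule continuous_on_subset) (use t in auto)
  qed
  fix \<theta> assume \<theta>: "\<theta> \<in> {-\<tau>..0}"
  show "(\<lambda>\<omega>. segment \<tau> y t \<omega> \<theta>) \<in> borel_measurable (F t)"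
  proof (cases "s \<le> t + \<theta>")
    case True
    have "y (t + \<theta>) \<in> borel_measurable (F (t + \<theta>))"
      using y True unfolding sdde_solution_def by blast
    then have "y (t + \<theta>) \<in> borel_measurable (F t)"
      by (rule measurable_from_subalg[OF usual_filtration_mono[OF filt], rotated 2])
        (use True \<theta> s in auto)
    then show ?thesis using \<theta> by (simp add: segment_def)
  next
    case False
    have \<theta>': "t + \<theta> - s \<in> {-\<tau>..0}" using False \<theta> t by auto
    have "(\<lambda>\<omega>. \<eta> \<omega> (t + \<theta> - s)) \<in> borel_measurable (F s)"
      by (rule measurable_Cborel_eval[OF _ \<theta>' \<eta>]) (use \<tau> in auto)
    then have 1: "(\<lambda>\<omega>. \<eta> \<omega> (t + \<theta> - s)) \<in> borel_measurable (F t)"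
      by (rule measurable_from_subalg[OF usual_filtration_mono[OF filt s t]])
    have "y (s + (t + \<theta> - s)) \<omega> = \<eta> \<omega> (t + \<theta> - s)" if "\<omega> \<in> space M" for \<omega>
      using y \<theta>' that unfolding sdde_solution_def by blast
    then have eq: "segment \<tau> y t \<omega> \<theta> = \<eta> \<omega> (t + \<theta> - s)" if "\<omega> \<in> space (F t)" for \<omega>
      using that sp \<theta> by (simp add: segment_def)
    show ?thesis by (subst measurable_cong[OF eq]) (use 1 in auto)
  qed
qed

text \<open>Uniqueness compares solutions only from \<open>s\<close> on, while a segment shortly
  after \<open>s\<close> reaches back before it; there the common initial segment takes
  over.\<close>

lemma segment_solution_cong:
  assumes y: "sdde_solution M F W \<tau> f g s \<eta> y" and z: "sdde_solution M F W \<tau> f g s \<eta>' z"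
    and \<omega>: "\<omega> \<in> space M" "\<eta> \<omega> = \<eta>' \<omega>" and yz: "\<forall>t\<ge>s. y t \<omega> = z t \<omega>" and t: "s \<le> t"
  shows "segment \<tau> y t \<omega> = segment \<tau> z t \<omega>"
proof -
  have "y (t + \<theta>) \<omega> = z (t + \<theta>) \<omega>" if \<theta>: "\<theta> \<in> {-\<tau>..0}" for \<theta>
  proof (cases "s \<le> t + \<theta>")
    case False
    then have "t + \<theta> - s \<in> {-\<tau>..0}" using \<theta> t by auto
    then have "y (s + (t + \<theta> - s)) \<omega> = \<eta> \<omega> (t + \<theta> - s)" "z (s + (t + \<theta> - s)) \<omega> = \<eta>' \<omega> (t + \<theta> - s)"
      using y z \<omega>(1) unfolding sdde_solution_def by blast+
    then show ?thesis using \<omega>(2) by simp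
  qed (use yz in auto)
  then show ?thesis unfolding segment_def by (intro restrict_ext)
qed

text \<open>The old solution also solves the equation restarted from its own segment at
  \<open>s\<close>, so uniqueness identifies it with the solution selected by \<open>x\<close>. One
  null set serves all \<open>t\<close>.\<close>

lemma sdde_flow:
  fixes x :: "real \<Rightarrow> ('w \<Rightarrow> real \<Rightarrow> real ^ 'd) \<Rightarrow> real \<Rightarrow> 'w \<Rightarrow> real ^ 'd"
  assumes filt: "usual_filtration M F" and \<tau>: "0 < \<tau>" and sol: "sdde_unique_solution M F W \<tau> f g x"
    and s: "0 \<le> s\<^sub>0" "s\<^sub>0 \<le> s" and \<eta>: "\<eta> \<in> F s\<^sub>0 \<rightarrow>\<^sub>M Cborel \<tau>"
  shows "AE \<omega> in M. \<forall>t\<ge>s. segment \<tau> (x s\<^sub>0 \<eta>) t \<omega> = segment \<tau> (x s (segment \<tau> (x s\<^sub>0 \<eta>) s)) t \<omega>"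
proof -
  let ?\<eta>' = "segment \<tau> (x s\<^sub>0 \<eta>) s"
  have y: "sdde_solution M F W \<tau> f g s\<^sub>0 \<eta> (x s\<^sub>0 \<eta>)"
    using sol s \<eta> unfolding sdde_unique_solution_def by blast
  have y': "sdde_solution M F W \<tau> f g s ?\<eta>' (x s\<^sub>0 \<eta>)"
    using sdde_solution_restart[OF filt s _ y] \<tau> by simp
  have \<eta>': "?\<eta>' \<in> F s \<rightarrow>\<^sub>M Cborel \<tau>"
    by (rule segment_solution_measurable[OF filt \<tau> s \<eta> y])
  have "0 \<le> s" using s by simp
  then have z: "sdde_solution M F W \<tau> f g s ?\<eta>' (x s ?\<eta>')"
    and "AE \<omega> in M. \<forall>t\<ge>s. x s\<^sub>0 \<eta> t \<omega> = x s ?\<eta>' t \<omega>"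
    using sol \<eta>' y' unfolding sdde_unique_solution_def by blast+
  from this(2) AE_space show ?thesis
    by eventually_elim (use segment_solution_cong[OF y' z] in blast)
qed

text \<open>Following \<open>x s \<eta>'\<close> on \<open>A\<close> and \<open>x s \<eta>\<close>
  off \<open>A\<close> gives a solution with initial segment \<open>\<eta>\<close>, since the data
  agree on \<open>A\<close>; by uniqueness it is \<open>x s \<eta>\<close>.\<close>

lemma sdde_local:
  fixes x :: "real \<Rightarrow> ('w \<Rightarrow> real \<Rightarrow> real ^ 'd) \<Rightarrow> real \<Rightarrow> 'w \<Rightarrow> real ^ 'd"
  assumes filt: "usual_filtration M F" and sol: "sdde_unique_solution M F W \<tau> f g x" and s: "0 \<le> s"
    and \<eta>: "\<eta> \<in> F s \<rightarrow>\<^sub>M Cborel \<tau>" "\<eta>' \<in> F s \<rightarrow>\<^sub>M Cborel \<tau>"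
    and A: "A \<in> sets (F s)" "\<And>\<omega>. \<omega> \<in> A \<Longrightarrow> \<eta> \<omega> = \<eta>' \<omega>"
  shows "AE \<omega> in M. \<omega> \<in> A \<longrightarrow> (\<forall>t\<ge>s. segment \<tau> (x s \<eta>) t \<omega> = segment \<tau> (x s \<eta>') t \<omega>)"
proof -
  have y: "sdde_solution M F W \<tau> f g s \<eta> (x s \<eta>)" and z: "sdde_solution M F W \<tau> f g s \<eta>' (x s \<eta>')"
    using sol s \<eta> unfolding sdde_unique_solution_def by blast+
  have "(\<lambda>\<omega>. if \<omega> \<in> A then \<eta>' \<omega> else \<eta> \<omega>) = \<eta>" using A(2) by auto
  then have "sdde_solution M F W \<tau> f g s \<eta> (\<lambda>t \<omega>. if \<omega> \<in> A then x s \<eta>' t \<omega> else x s \<eta> t \<omega>)"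
    using sdde_solution_If[OF filt s A(1) z y] by simp
  then have "AE \<omega> in M. \<forall>t\<ge>s. (if \<omega> \<in> A then x s \<eta>' t \<omega> else x s \<eta> t \<omega>) = x s \<eta> t \<omega>"
    using sol s \<eta> unfolding sdde_unique_solution_def by blast
  then show ?thesis using AE_space
  proof eventually_elim
    case (elim \<omega>)
    show ?case
    proof (intro impI allI)
      fix t assume "\<omega> \<in> A" "s \<le> t"
      then show "segment \<tau> (x s \<eta>) t \<omega> = segment \<tau> (x s \<eta>') t \<omega>"
        using elim A(2) by (intro segment_solution_cong[OF y z]) auto
    qed
  qed
qed

lemma numerical_flow:
  fixes X :: "real \<Rightarrow> ('w \<Rightarrow> real \<Rightarrow> real ^ 'd) \<Rightarrow> real \<Rightarrow> 'w \<Rightarrow> real ^ 'd"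
  assumes num: "numerical_solution M F \<tau> \<Delta> X" and \<xi>: "\<xi> \<in> F 0 \<rightarrow>\<^sub>M Cborel \<tau>"
    and s: "s \<in> grid_times \<Delta>" "0 \<le> s"
  shows "AE \<omega> in M. \<forall>t\<ge>s. segment \<tau> (X 0 \<xi>) t \<omega> = segment \<tau> (X s (segment \<tau> (X 0 \<xi>) s)) t \<omega>"
proof -
  let ?\<eta> = "segment \<tau> (X 0 \<xi>) s"
  have "0 \<in> grid_times \<Delta>" by (auto simp: grid_times_def intro: exI[of _ 0])
  then have \<eta>: "?\<eta> \<in> F s \<rightarrow>\<^sub>M Cborel \<tau>"
    using num \<xi> s unfolding numerical_solution_def by blast
  have init: "\<forall>\<omega>\<in>space M. \<forall>\<theta>\<in>{-\<tau>..0}. X s ?\<eta> (s + \<theta>) \<omega> = ?\<eta> \<omega> \<theta>"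
    using num \<eta> s unfolding numerical_solution_def by blast
  have "AE \<omega> in M. \<forall>t>s. X 0 \<xi> t \<omega> = X s ?\<eta> t \<omega>"
    using num \<xi> s unfolding numerical_solution_def by blast
  then show ?thesis using AE_space
  proof eventually_elim
    case (elim \<omega>)
    show ?case
    proof (intro allI impI)
      fix t assume t: "s \<le> t"
      have "X 0 \<xi> (t + \<theta>) \<omega> = X s ?\<eta> (t + \<theta>) \<omega>" if \<theta>: "\<theta> \<in> {-\<tau>..0}" for \<theta>
      \<comment> \<open>The flow property is given for times strictly after \<open>s\<close>; at
        \<open>s\<close> and before, the initial condition of the restarted scheme supplies the
        values.\<close>
      proof (cases "s < t + \<theta>")
        case False
        then have *: "t + \<theta> - s \<in> {-\<tau>..0}" using \<theta> t by auto
        then have "X s ?\<eta> (s + (t + \<theta> - s)) \<omega> = ?\<eta> \<omega> (t + \<theta> - s)"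
          using init elim(2) by blast
        then show ?thesis using * by (simp add: segment_def)
      qed (use elim in auto)
      then show "segment \<tau> (X 0 \<xi>) t \<omega> = segment \<tau> (X s ?\<eta>) t \<omega>"
        unfolding segment_def by (intro restrict_ext)
    qed
  qed
qed

section \<open>Moments of \<open>C\<close>-valued random variables\<close>

lemma
  fixes Y Z :: "'w \<Rightarrow> real \<Rightarrow> real ^ 'd"
  assumes \<tau>: "0 \<le> \<tau>" and Y: "Y \<in> N \<rightarrow>\<^sub>M Cborel \<tau>" and Z: "Z \<in> N \<rightarrow>\<^sub>M Cborel \<tau>"
  shows measurable_Cborel_Cnorm: "(\<lambda>\<omega>. Cnorm \<tau> (Y \<omega>)) \<in> borel_measurable N"
    and measurable_Cborel_Cnorm_diff: "(\<lambda>\<omega>. Cnorm \<tau> (\<lambda>\<theta>. Y \<omega> \<theta> - Z \<omega> \<theta>)) \<in> borel_measurable N"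
proof -
  have cont: "continuous_on {-\<tau>..0} (Y \<omega>)" "continuous_on {-\<tau>..0} (Z \<omega>)" if "\<omega> \<in> space N" for \<omega>
    using measurable_space[OF Y that] measurable_space[OF Z that]
    by (auto simp: space_Cborel mspace_Cspace)
  note meas = measurable_Cborel_eval[OF \<tau> _ Y] measurable_Cborel_eval[OF \<tau> _ Z]
  show "(\<lambda>\<omega>. Cnorm \<tau> (Y \<omega>)) \<in> borel_measurable N"
    by (rule borel_measurable_Cnorm[OF \<tau> meas(1) cont(1)])
  show "(\<lambda>\<omega>. Cnorm \<tau> (\<lambda>\<theta>. Y \<omega> \<theta> - Z \<omega> \<theta>)) \<in> borel_measurable N"
    by (rule borel_measurable_Cnorm[OF \<tau>]) (auto intro!: continuous_intros borel_measurable_diff meas cont)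
qed

lemma moment_cong_AE:
  assumes "AE \<omega> in M. \<forall>\<theta>\<in>{-\<tau>..0}. Y \<omega> \<theta> = Z \<omega> \<theta>"
  shows "moment M \<tau> p Y = moment M \<tau> p Z"
  unfolding moment_def
proof (rule nn_integral_cong_AE)
  show "AE \<omega> in M. ennreal (Cnorm \<tau> (Y \<omega>) powr p) = ennreal (Cnorm \<tau> (Z \<omega>) powr p)"
    using assms
  proof eventually_elim
    case (elim \<omega>)
    then have "Cnorm \<tau> (Y \<omega>) = Cnorm \<tau> (Z \<omega>)" by (intro Cnorm_cong) simp
    then show ?case by simp
  qed
qed

lemma moment_add_le:
  assumes \<tau>: "0 \<le> \<tau>" and p: "0 < p"
    and meas: "(\<lambda>\<omega>. Cnorm \<tau> (Y \<omega>)) \<in> borel_measurable M" "(\<lambda>\<omega>. Cnorm \<tau> (Z \<omega>)) \<in> borel_measurable M"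
    and cont: "\<And>\<omega>. \<omega> \<in> space M \<Longrightarrow> continuous_on {-\<tau>..0} (Y \<omega>)"
      "\<And>\<omega>. \<omega> \<in> space M \<Longrightarrow> continuous_on {-\<tau>..0} (Z \<omega>)"
  shows "moment M \<tau> p (\<lambda>\<omega> \<theta>. Y \<omega> \<theta> + Z \<omega> \<theta>) \<le> ennreal (2 powr p) * (moment M \<tau> p Y + moment M \<tau> p Z)"
proof -
  have "moment M \<tau> p (\<lambda>\<omega> \<theta>. Y \<omega> \<theta> + Z \<omega> \<theta>)
      \<le> (\<integral>\<^sup>+\<omega>. ennreal (2 powr p) * (ennreal (Cnorm \<tau> (Y \<omega>) powr p) + ennreal (Cnorm \<tau> (Z \<omega>) powr p)) \<partial>M)"
    unfolding moment_def
  proof (rule nn_integral_mono)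
    fix \<omega> assume \<omega>: "\<omega> \<in> space M"
    have nn: "0 \<le> Cnorm \<tau> (Y \<omega>)" "0 \<le> Cnorm \<tau> (Z \<omega>)" "0 \<le> Cnorm \<tau> (\<lambda>\<theta>. Y \<omega> \<theta> + Z \<omega> \<theta>)"
      using cont[OF \<omega>] \<tau> by (auto intro!: Cnorm_nonneg continuous_intros)
    have "Cnorm \<tau> (\<lambda>\<theta>. Y \<omega> \<theta> + Z \<omega> \<theta>) powr p \<le> (Cnorm \<tau> (Y \<omega>) + Cnorm \<tau> (Z \<omega>)) powr p"
      using Cnorm_add_le[OF \<tau> cont[OF \<omega>]] nn p by (intro powr_mono2) auto
    also have "\<dots> \<le> 2 powr p * (Cnorm \<tau> (Y \<omega>) powr p + Cnorm \<tau> (Z \<omega>) powr p)"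
      using nn p by (intro powr_add_le_2_powr)
    finally show "ennreal (Cnorm \<tau> (\<lambda>\<theta>. Y \<omega> \<theta> + Z \<omega> \<theta>) powr p)
        \<le> ennreal (2 powr p) * (ennreal (Cnorm \<tau> (Y \<omega>) powr p) + ennreal (Cnorm \<tau> (Z \<omega>) powr p))"
      by (simp add: ennreal_leI flip: ennreal_plus ennreal_mult)
  qed
  also have "\<dots> = ennreal (2 powr p) * (moment M \<tau> p Y + moment M \<tau> p Z)"
    unfolding moment_def using meas by (subst nn_integral_cmult, measurable, subst nn_integral_add) auto
  finally show ?thesis .
qed

lemma moment_diff_triangle:
  fixes Y Z V :: "'w \<Rightarrow> real \<Rightarrow> real ^ 'd"
  assumes \<tau>: "0 \<le> \<tau>" and p: "0 < p"
    and Y: "Y \<in> M \<rightarrow>\<^sub>M Cborel \<tau>" and Z: "Z \<in> M \<rightarrow>\<^sub>M Cborel \<tau>" and V: "V \<in> M \<rightarrow>\<^sub>M Cborel \<tau>"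
  shows "moment M \<tau> p (\<lambda>\<omega> \<theta>. Y \<omega> \<theta> - V \<omega> \<theta>) \<le> ennreal (2 powr p) *
    (moment M \<tau> p (\<lambda>\<omega> \<theta>. Y \<omega> \<theta> - Z \<omega> \<theta>) + moment M \<tau> p (\<lambda>\<omega> \<theta>. Z \<omega> \<theta> - V \<omega> \<theta>))"
proof -
  have cont: "continuous_on {-\<tau>..0} (Y \<omega>)" "continuous_on {-\<tau>..0} (Z \<omega>)" "continuous_on {-\<tau>..0} (V \<omega>)"
    if "\<omega> \<in> space M" for \<omega>
    using measurable_space[OF Y that] measurable_space[OF Z that] measurable_space[OF V that]
    by (auto simp: space_Cborel mspace_Cspace)
  have "moment M \<tau> p (\<lambda>\<omega> \<theta>. (Y \<omega> \<theta> - Z \<omega> \<theta>) + (Z \<omega> \<theta> - V \<omega> \<theta>)) \<le> ennreal (2 powr p) *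
    (moment M \<tau> p (\<lambda>\<omega> \<theta>. Y \<omega> \<theta> - Z \<omega> \<theta>) + moment M \<tau> p (\<lambda>\<omega> \<theta>. Z \<omega> \<theta> - V \<omega> \<theta>))"
    using Y Z V \<tau> by (intro moment_add_le p) (auto intro!: measurable_Cborel_Cnorm_diff continuous_intros cont)
  then show ?thesis by simp
qed

text \<open>The difference has \<open>Z\<close> first because in its use \<open>Z\<close> is the
  exact segment, and (iv) estimates exact minus numerical.\<close>

lemma moment_le_add_diff:
  fixes Y Z :: "'w \<Rightarrow> real \<Rightarrow> real ^ 'd"
  assumes \<tau>: "0 \<le> \<tau>" and p: "0 < p"
    and Y: "Y \<in> M \<rightarrow>\<^sub>M Cborel \<tau>" and Z: "Z \<in> M \<rightarrow>\<^sub>M Cborel \<tau>"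
  shows "moment M \<tau> p Y \<le> ennreal (2 powr p) *
    (moment M \<tau> p Z + moment M \<tau> p (\<lambda>\<omega> \<theta>. Z \<omega> \<theta> - Y \<omega> \<theta>))"
proof -
  have cont: "continuous_on {-\<tau>..0} (Y \<omega>)" "continuous_on {-\<tau>..0} (Z \<omega>)"
    if "\<omega> \<in> space M" for \<omega>
    using measurable_space[OF Y that] measurable_space[OF Z that]
    by (auto simp: space_Cborel mspace_Cspace)
  have "moment M \<tau> p (\<lambda>\<omega> \<theta>. Z \<omega> \<theta> + (Y \<omega> \<theta> - Z \<omega> \<theta>)) \<le> ennreal (2 powr p) *
    (moment M \<tau> p Z + moment M \<tau> p (\<lambda>\<omega> \<theta>. Y \<omega> \<theta> - Z \<omega> \<theta>))"
    by (rule moment_add_le[OF \<tau> p measurable_Cborel_Cnorm[OF \<tau> Z Z] measurable_Cborel_Cnorm_diff[OF \<tau> Y Z]])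
      (auto intro!: continuous_intros cont)
  moreover have "moment M \<tau> p (\<lambda>\<omega> \<theta>. Y \<omega> \<theta> - Z \<omega> \<theta>) = moment M \<tau> p (\<lambda>\<omega> \<theta>. Z \<omega> \<theta> - Y \<omega> \<theta>)"
    by (simp add: moment_def Cnorm_def norm_minus_commute)
  ultimately show ?thesis by simp
qed

lemma moment_eq_0:
  fixes Y :: "'w \<Rightarrow> real \<Rightarrow> real ^ 'd"
  assumes "0 \<le> \<tau>" "0 < p" "AE \<omega> in M. \<forall>\<theta>\<in>{-\<tau>..0}. Y \<omega> \<theta> = 0"
  shows "moment M \<tau> p Y = 0"
proof -
  have "moment M \<tau> p Y = moment M \<tau> p (\<lambda>_ _. 0 :: real ^ 'd)" by (rule moment_cong_AE) (use assms(3) in simp)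
  also have "\<dots> = 0" using assms(1) by (simp add: moment_def Cnorm_def)
  finally show ?thesis .
qed

text \<open>Ulam's theorem makes the data compact-valued off a set of small probability; there the data are
  replaced by a constant, which by uniqueness does not change the solutions elsewhere.\<close>

lemma sdde_contraction_extends:
  fixes x :: "real \<Rightarrow> ('w \<Rightarrow> real \<Rightarrow> real ^ 'd) \<Rightarrow> real \<Rightarrow> 'w \<Rightarrow> real ^ 'd"
    and c :: ennreal
  assumes prob: "prob_space M" and filt: "usual_filtration M F" and \<tau>: "0 < \<tau>"
    and sol: "sdde_unique_solution M F W \<tau> f g x" and p: "0 < p" and s: "0 \<le> s" and t: "s \<le> t"
    and contr: "\<And>K \<xi> \<eta>. compactin (mtopology_of (Cspace \<tau>)) K \<Longrightarrow> \<xi> \<in> F s \<rightarrow>\<^sub>M Cborel \<tau> \<Longrightarrow> \<eta> \<in> F s \<rightarrow>\<^sub>M Cborel \<tau> \<Longrightarrow>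
      (\<forall>\<omega>\<in>space M. \<xi> \<omega> \<in> K \<and> \<eta> \<omega> \<in> K) \<Longrightarrow>
      moment M \<tau> p (\<lambda>\<omega> \<theta>. segment \<tau> (x s \<xi>) t \<omega> \<theta> - segment \<tau> (x s \<eta>) t \<omega> \<theta>)
        \<le> c * moment M \<tau> p (\<lambda>\<omega> \<theta>. \<xi> \<omega> \<theta> - \<eta> \<omega> \<theta>)"
    and \<xi>: "\<xi> \<in> F s \<rightarrow>\<^sub>M Cborel \<tau>" and \<eta>: "\<eta> \<in> F s \<rightarrow>\<^sub>M Cborel \<tau>"
  shows "moment M \<tau> p (\<lambda>\<omega> \<theta>. segment \<tau> (x s \<xi>) t \<omega> \<theta> - segment \<tau> (x s \<eta>) t \<omega> \<theta>)
    \<le> c * moment M \<tau> p (\<lambda>\<omega> \<theta>. \<xi> \<omega> \<theta> - \<eta> \<omega> \<theta>)"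
proof -
  interpret prob_space M by fact
  interpret C: Metric_space "mspace (Cspace \<tau>)" "mdist (Cspace \<tau>) :: (real \<Rightarrow> real ^ 'd) \<Rightarrow> _"
    by (rule Metric_space_mspace_mdist)
  have top: "mtopology_of (Cspace \<tau> :: (real \<Rightarrow> real ^ 'd) metric) = C.mtopology"
    by (simp add: mtopology_of_def)
  note subM = usual_filtration_subalgebra[OF filt]
  have Fs: "space (F s) = space M" "sets (F s) \<subseteq> sets M"
    using subM[OF s] by (auto simp: subalgebra_def)
  note \<xi>M = measurable_from_subalg[OF subM[OF s] \<xi>] and \<eta>M = measurable_from_subalg[OF subM[OF s] \<eta>]
  \<comment> \<open>The replacement value off the good event: zero on the interval and
    \<open>undefined\<close> elsewhere, as membership in the space demands.\<close>
  define c0 :: "real \<Rightarrow> real ^ 'd" where "c0 = (\<lambda>\<theta>\<in>{-\<tau>..0}. 0)"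
  have c0: "c0 \<in> mspace (Cspace \<tau>)"
    by (auto simp: mspace_Cspace c0_def intro: continuous_on_cong[THEN iffD1, OF refl _ continuous_on_const[of _ 0]])
  have "\<exists>K. compactin C.mtopology K \<and> measure M {\<omega>\<in>space M. \<xi> \<omega> \<notin> K} \<le> 1 / Suc n" for n
    using tight_Cborel[OF \<tau> prob \<xi>M, of "1 / Suc n"] top by auto
  then obtain K where K: "\<And>n. compactin C.mtopology (K n)"
      "\<And>n. measure M {\<omega>\<in>space M. \<xi> \<omega> \<notin> K n} \<le> 1 / Suc n"
    using choice[of "\<lambda>n K. compactin C.mtopology K \<and> measure M {\<omega>\<in>space M. \<xi> \<omega> \<notin> K} \<le> 1 / Suc n"] by blast
  have "\<exists>L. compactin C.mtopology L \<and> measure M {\<omega>\<in>space M. \<eta> \<omega> \<notin> L} \<le> 1 / Suc n" for n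
    using tight_Cborel[OF \<tau> prob \<eta>M, of "1 / Suc n"] top by auto
  then obtain L where L: "\<And>n. compactin C.mtopology (L n)"
      "\<And>n. measure M {\<omega>\<in>space M. \<eta> \<omega> \<notin> L n} \<le> 1 / Suc n"
    using choice[of "\<lambda>n L. compactin C.mtopology L \<and> measure M {\<omega>\<in>space M. \<eta> \<omega> \<notin> L} \<le> 1 / Suc n"] by blast
  \<comment> \<open>Increasing in \<open>n\<close>, and containing \<open>c0\<close> so that the
    modified data stay in one compact set.\<close>
  define H where "H n = {c0} \<union> (\<Union>i\<le>n. K i \<union> L i)" for n
  have H: "compactin C.mtopology (H n)" for n
    unfolding H_def using c0 K(1) L(1)
    by (intro compactin_Un compactin_Union finite_imageI) (auto intro!: compactin_Un simp: finite_imp_compactin)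
  have H_mono: "H m \<subseteq> H n" if "m \<le> n" for m n using that unfolding H_def by fastforce
  have H_sets: "H n \<in> sets (Cborel \<tau>)" for n
    unfolding Cborel_eq
    by (intro C.closedin_in_sets_sigma_openin compactin_imp_closedin H C.Hausdorff_space_mtopology)
  define A where "A n = {\<omega>\<in>space M. \<xi> \<omega> \<in> H n \<and> \<eta> \<omega> \<in> H n}" for n
  have "A n = (\<xi> -` H n \<inter> space (F s)) \<inter> (\<eta> -` H n \<inter> space (F s))" for n
    using Fs by (auto simp: A_def)
  then have A: "A n \<in> sets (F s)" for n
    using measurable_sets[OF \<xi> H_sets] measurable_sets[OF \<eta> H_sets] by simp
  then have AM: "A n \<in> sets M" for n using Fs by auto
  have A_mono: "A m \<subseteq> A n" if "m \<le> n" for m n using H_mono[OF that] by (auto simp: A_def)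
  let ?Y = "\<lambda>\<omega> \<theta>. segment \<tau> (x s \<xi>) t \<omega> \<theta> - segment \<tau> (x s \<eta>) t \<omega> \<theta>"
  let ?h = "\<lambda>\<omega>. ennreal (Cnorm \<tau> (?Y \<omega>) powr p)"
  have sol_meas: "segment \<tau> (x s \<zeta>) t \<in> M \<rightarrow>\<^sub>M Cborel \<tau>" if "\<zeta> \<in> F s \<rightarrow>\<^sub>M Cborel \<tau>" for \<zeta>
  proof -
    have "sdde_solution M F W \<tau> f g s \<zeta> (x s \<zeta>)"
      using sol s that unfolding sdde_unique_solution_def by blast
    from segment_solution_measurable[OF filt \<tau> s t that this] show ?thesis
      by (rule measurable_from_subalg[OF subM, rotated]) (use s t in auto)
  qed
  have [measurable]: "(\<lambda>\<omega>. Cnorm \<tau> (?Y \<omega>)) \<in> borel_measurable M"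
    using \<tau> by (intro measurable_Cborel_Cnorm_diff sol_meas \<xi> \<eta>) auto
  have bound: "(\<integral>\<^sup>+\<omega>. ?h \<omega> * indicator (A n) \<omega> \<partial>M) \<le> c * moment M \<tau> p (\<lambda>\<omega> \<theta>. \<xi> \<omega> \<theta> - \<eta> \<omega> \<theta>)" for n
  proof -
    \<comment> \<open>Data that agree with the given ones on \<open>A n\<close> and take values in
      \<open>H n\<close>, so that the compact case applies to them.\<close>
    define \<xi>n where "\<xi>n \<omega> = (if \<omega> \<in> A n then \<xi> \<omega> else c0)" for \<omega>
    define \<eta>n where "\<eta>n \<omega> = (if \<omega> \<in> A n then \<eta> \<omega> else c0)" for \<omega>
    have c0_meas: "(\<lambda>_. c0) \<in> F s \<rightarrow>\<^sub>M Cborel \<tau>"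
      using c0 by (intro measurable_const) (simp add: space_Cborel)
    have AF: "A n \<inter> space (F s) \<in> sets (F s)" using A by auto
    have \<xi>n: "\<xi>n \<in> F s \<rightarrow>\<^sub>M Cborel \<tau>"
      unfolding \<xi>n_def by (rule measurable_If_set[OF \<xi> c0_meas AF])
    have \<eta>n: "\<eta>n \<in> F s \<rightarrow>\<^sub>M Cborel \<tau>"
      unfolding \<eta>n_def by (rule measurable_If_set[OF \<eta> c0_meas AF])
    let ?Yn = "\<lambda>\<omega> \<theta>. segment \<tau> (x s \<xi>n) t \<omega> \<theta> - segment \<tau> (x s \<eta>n) t \<omega> \<theta>"
    have "AE \<omega> in M. \<omega> \<in> A n \<longrightarrow> (\<forall>r\<ge>s. segment \<tau> (x s \<xi>) r \<omega> = segment \<tau> (x s \<xi>n) r \<omega>)"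
      by (rule sdde_local[OF filt sol s \<xi> \<xi>n A]) (simp add: \<xi>n_def)
    moreover have "AE \<omega> in M. \<omega> \<in> A n \<longrightarrow> (\<forall>r\<ge>s. segment \<tau> (x s \<eta>) r \<omega> = segment \<tau> (x s \<eta>n) r \<omega>)"
      by (rule sdde_local[OF filt sol s \<eta> \<eta>n A]) (simp add: \<eta>n_def)
    ultimately have "AE \<omega> in M. ?h \<omega> * indicator (A n) \<omega> \<le> ennreal (Cnorm \<tau> (?Yn \<omega>) powr p)"
      by eventually_elim (use t in \<open>auto simp: indicator_def\<close>)
    then have "(\<integral>\<^sup>+\<omega>. ?h \<omega> * indicator (A n) \<omega> \<partial>M) \<le> moment M \<tau> p ?Yn"
      unfolding moment_def by (rule nn_integral_mono_AE)
    also have "\<dots> \<le> c * moment M \<tau> p (\<lambda>\<omega> \<theta>. \<xi>n \<omega> \<theta> - \<eta>n \<omega> \<theta>)"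
    proof (rule contr[OF _ \<xi>n \<eta>n])
      show "compactin (mtopology_of (Cspace \<tau>)) (H n)" using H top by simp
      show "\<forall>\<omega>\<in>space M. \<xi>n \<omega> \<in> H n \<and> \<eta>n \<omega> \<in> H n"
        by (auto simp: \<xi>n_def \<eta>n_def A_def H_def)
    qed
    \<comment> \<open>Off \<open>A n\<close> both data are \<open>c0\<close>, so their difference
      vanishes there and the moment can only drop.\<close>
    also have "\<dots> \<le> c * moment M \<tau> p (\<lambda>\<omega> \<theta>. \<xi> \<omega> \<theta> - \<eta> \<omega> \<theta>)"
      unfolding moment_def using \<tau>
      by (intro mult_left_mono nn_integral_mono) (auto simp: \<xi>n_def \<eta>n_def Cnorm_def)
    finally show ?thesis .
  qed
  \<comment> \<open>Outside the union of the \<open>A n\<close> at least one of the data misses its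
    \<open>n\<close>th compact set, whatever \<open>n\<close> is; each miss has probability at most
    \<open>1 / Suc n\<close>.\<close>
  have "measure M (space M - (\<Union>n. A n)) \<le> 2 / Suc n" for n
  proof -
    have sets: "{\<omega>\<in>space M. \<xi> \<omega> \<notin> K n} \<in> sets M" "{\<omega>\<in>space M. \<eta> \<omega> \<notin> L n} \<in> sets M"
    proof -
      have "K n \<in> sets (Cborel \<tau>)" "L n \<in> sets (Cborel \<tau>)"
        unfolding Cborel_eq
        by (intro C.closedin_in_sets_sigma_openin compactin_imp_closedin K L C.Hausdorff_space_mtopology)+
      then have "space M - (\<xi> -` K n \<inter> space M) \<in> sets M" "space M - (\<eta> -` L n \<inter> space M) \<in> sets M"
        using measurable_sets[OF \<xi>M] measurable_sets[OF \<eta>M] by auto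
      moreover have "space M - (\<xi> -` K n \<inter> space M) = {\<omega>\<in>space M. \<xi> \<omega> \<notin> K n}"
        "space M - (\<eta> -` L n \<inter> space M) = {\<omega>\<in>space M. \<eta> \<omega> \<notin> L n}" by auto
      ultimately show "{\<omega>\<in>space M. \<xi> \<omega> \<notin> K n} \<in> sets M" "{\<omega>\<in>space M. \<eta> \<omega> \<notin> L n} \<in> sets M" by simp_all
    qed
    have "space M - (\<Union>n. A n) \<subseteq> {\<omega>\<in>space M. \<xi> \<omega> \<notin> K n} \<union> {\<omega>\<in>space M. \<eta> \<omega> \<notin> L n}"
      by (auto simp: A_def H_def)
    then have "measure M (space M - (\<Union>n. A n))
        \<le> measure M ({\<omega>\<in>space M. \<xi> \<omega> \<notin> K n} \<union> {\<omega>\<in>space M. \<eta> \<omega> \<notin> L n})"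
      using sets by (intro finite_measure_mono) auto
    also have "\<dots> \<le> measure M {\<omega>\<in>space M. \<xi> \<omega> \<notin> K n} + measure M {\<omega>\<in>space M. \<eta> \<omega> \<notin> L n}"
      by (intro measure_Un_le sets)
    also have "\<dots> \<le> 2 / Suc n" using K(2)[of n] L(2)[of n] by (simp add: add_divide_distrib)
    finally show ?thesis .
  qed
  then have "measure M (space M - (\<Union>n. A n)) \<le> 0"
    using LIMSEQ_le_const[OF lim_const_over_n[of 2, THEN LIMSEQ_Suc]] by blast
  then have "measure M (space M - (\<Union>n. A n)) = 0" by (simp add: measure_le_0_iff)
  then have "space M - (\<Union>n. A n) \<in> null_sets M"
    using AM by (intro null_setsI) (auto simp: emeasure_eq_measure)
  then have AE_A: "AE \<omega> in M. \<omega> \<in> (\<Union>n. A n)" by (rule AE_I') auto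
  have SUP_eq: "(SUP n. ?h \<omega> * indicator (A n) \<omega>) = ?h \<omega>" if \<omega>: "\<omega> \<in> (\<Union>n. A n)" for \<omega>
  proof (rule antisym)
    obtain n where n: "\<omega> \<in> A n" using \<omega> by auto
    then have "?h \<omega> = ?h \<omega> * indicator (A n) \<omega>" by simp
    also have "\<dots> \<le> (SUP n. ?h \<omega> * indicator (A n) \<omega>)" by (rule SUP_upper) simp
    finally show "?h \<omega> \<le> (SUP n. ?h \<omega> * indicator (A n) \<omega>)" .
    show "(SUP n. ?h \<omega> * indicator (A n) \<omega>) \<le> ?h \<omega>"
      by (rule SUP_least) (simp add: indicator_def)
  qed
  \<comment> \<open>The events \<open>A n\<close> increase to a set of full measure and
    \<open>bound\<close> is uniform in \<open>n\<close>, so monotone convergence finishes.\<close>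
  have "moment M \<tau> p ?Y = (\<integral>\<^sup>+\<omega>. (SUP n. ?h \<omega> * indicator (A n) \<omega>) \<partial>M)"
    unfolding moment_def
    by (rule nn_integral_cong_AE) (use AE_A in eventually_elim, simp only: SUP_eq)
  also have "\<dots> = (SUP n. \<integral>\<^sup>+\<omega>. ?h \<omega> * indicator (A n) \<omega> \<partial>M)"
  proof (rule nn_integral_monotone_convergence_SUP)
    show "incseq (\<lambda>n \<omega>. ?h \<omega> * indicator (A n) \<omega>)"
      using A_mono by (auto simp: incseq_def le_fun_def indicator_def)
    show "(\<lambda>\<omega>. ?h \<omega> * indicator (A n) \<omega>) \<in> borel_measurable M" for n
      using AM by measurable
  qed
  also have "\<dots> \<le> c * moment M \<tau> p (\<lambda>\<omega> \<theta>. \<xi> \<omega> \<theta> - \<eta> \<omega> \<theta>)"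
    by (intro SUP_least bound)
  finally show ?thesis .
qed

section \<open>Strong convergence in the infinite horizon\<close>

lemma exp_neg_le_eventually:
  fixes a b c :: real
  assumes a: "0 < a" and b: "0 < b" and c: "0 < c"
  shows "\<exists>n0. \<forall>n\<ge>n0. a * exp (- (c * real n)) \<le> b"
proof -
  obtain n0 :: nat where n0: "a / (b * c) < n0" using reals_Archimedean2 by blast
  have "a * exp (- (c * real n)) \<le> b" if n: "n0 \<le> n" for n
  proof -
    have "a / (b * c) \<le> real n" using n0 n by linarith
    then have "a \<le> b * (c * real n)" using b c by (simp add: divide_le_eq mult_ac)
    also have "\<dots> \<le> b * exp (c * real n)"
      using b exp_ge_add_one_self[of "c * real n"] by (intro mult_left_mono) linarith+
    finally show ?thesis by (simp add: exp_minus field_simps)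
  qed
  then show ?thesis by blast
qed

text \<open>The bound \<open>b + 2 * L\<close> is preserved by the recursion: \<open>2 * L\<close>
  is its fixed point and \<open>b\<close> covers the start. The terms are not assumed finite;
  finiteness comes out of the induction.\<close>

lemma ennreal_half_recursion:
  fixes a :: "nat \<Rightarrow> ennreal"
  assumes b: "0 \<le> b" and L: "0 \<le> L" and a0: "a 0 \<le> ennreal b"
    and step: "\<And>j. a (Suc j) \<le> ennreal (1/2) * a j + ennreal L"
  shows "a j \<le> ennreal (b + 2 * L)"
proof (induction j)
  case 0
  show ?case using L by (intro order_trans[OF a0] ennreal_leI) simp
next
  case (Suc j)
  have "a (Suc j) \<le> ennreal (1/2) * ennreal (b + 2 * L) + ennreal L"
    using Suc by (intro order_trans[OF step] add_mono mult_left_mono) auto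
  also have "\<dots> = ennreal (1/2 * (b + 2 * L) + L)"
    using b L by (subst ennreal_plus, simp, simp, subst ennreal_mult) auto
  also have "\<dots> \<le> ennreal (b + 2 * L)" using b by (intro ennreal_leI) simp
  finally show ?case .
qed

text \<open>Coefficients are collected in \<open>ennreal\<close> because the moment \<open>m\<close>
  is not yet known to be finite.\<close>

lemma ennreal_combine:
  fixes m :: ennreal
  assumes "0 \<le> a" "0 \<le> c" "0 \<le> d" "0 \<le> e"
  shows "ennreal a * (ennreal c * m + ennreal d + ennreal e * (1 + m))
    = ennreal (a * c + a * e) * m + ennreal (a * d + a * e)"
  using assms by (simp add: ennreal_plus ennreal_mult algebra_simps)

theorem theorem3p6:
  fixes M :: "'w measure"
    and F :: "real \<Rightarrow> 'w measure"
    and W :: "real \<Rightarrow> 'w \<Rightarrow> real ^ 'm"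
    and f :: "(real ^ 'd) \<times> (real ^ 'd) \<Rightarrow> real ^ 'd"
    and g :: "(real ^ 'd) \<times> (real ^ 'd) \<Rightarrow> real ^ 'm ^ 'd"
    and x :: "real \<Rightarrow> ('w \<Rightarrow> real \<Rightarrow> real ^ 'd) \<Rightarrow> real \<Rightarrow> 'w \<Rightarrow> real ^ 'd"
    and X :: "real \<Rightarrow> real \<Rightarrow> ('w \<Rightarrow> real \<Rightarrow> real ^ 'd) \<Rightarrow> real \<Rightarrow> 'w \<Rightarrow> real ^ 'd"
    and C :: "real \<Rightarrow> real"
    and \<tau> p q K1 K2 K3 K4 K5 :: real
  assumes prob: "prob_space M"
    and filt: "usual_filtration M F"
    and BM: "brownian_motion M F W"
    and tau: "0 < \<tau>"
    and f_meas: "f \<in> borel_measurable borel"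
    and g_meas: "g \<in> borel_measurable borel"
    and sol: "sdde_unique_solution M F W \<tau> f g x"
    and p: "0 < p" and q: "0 < q"
    and i: "\<forall>\<Delta>\<in>step_sizes \<tau>. numerical_solution M F \<tau> \<Delta> (X \<Delta>) \<and>
              (\<forall>\<xi> \<in> F 0 \<rightarrow>\<^sub>M Cborel \<tau>.
                 homogeneous_markov M (Cborel \<tau>) (\<lambda>k. segment \<tau> (X \<Delta> 0 \<xi>) (real k * \<Delta>)))"
    and K123: "0 < K1" "0 < K2" "0 < K3"
    and ii: "\<forall>s\<ge>0. \<forall>\<xi> \<in> F s \<rightarrow>\<^sub>M Cborel \<tau>. \<forall>t\<ge>0.
              moment M \<tau> p (segment \<tau> (x s \<xi>) (s + t))
                \<le> ennreal K1 * moment M \<tau> p \<xi> * ennreal (exp (- K2 * t)) + ennreal K3"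
    and K45: "0 < K4" "0 < K5"
    and iii: "\<forall>K. compactin (mtopology_of (Cspace \<tau>)) K \<longrightarrow>
              (\<forall>s\<ge>0. \<forall>\<xi> \<in> F s \<rightarrow>\<^sub>M Cborel \<tau>. \<forall>\<eta> \<in> F s \<rightarrow>\<^sub>M Cborel \<tau>. \<forall>t\<ge>0.
                 (\<forall>\<omega>\<in>space M. \<xi> \<omega> \<in> K \<and> \<eta> \<omega> \<in> K) \<longrightarrow>
                 moment M \<tau> p (\<lambda>\<omega> \<theta>. segment \<tau> (x s \<xi>) (s + t) \<omega> \<theta> - segment \<tau> (x s \<eta>) (s + t) \<omega> \<theta>)
                   \<le> ennreal K4 * moment M \<tau> p (\<lambda>\<omega> \<theta>. \<xi> \<omega> \<theta> - \<eta> \<omega> \<theta>) * ennreal (exp (- K5 * t)))"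
    and C_pos: "\<forall>r>0. 0 < C r"
    and iv: "\<forall>\<Delta>\<in>step_sizes \<tau>. \<forall>\<xi> \<in> F 0 \<rightarrow>\<^sub>M Cborel \<tau>.
              \<forall>T1\<in>grid_times \<Delta>. \<forall>T2\<in>grid_times \<Delta>. 0 \<le> T1 \<and> T1 < T2 \<longrightarrow>
                (SUP k\<in>{k::int. T1 \<le> of_int k * \<Delta> \<and> of_int k * \<Delta> \<le> T2}.
                   moment M \<tau> p (\<lambda>\<omega> \<theta>.
                     segment \<tau> (x T1 (segment \<tau> (X \<Delta> 0 \<xi>) T1)) (of_int k * \<Delta>) \<omega> \<theta>
                     - segment \<tau> (X \<Delta> T1 (segment \<tau> (X \<Delta> 0 \<xi>) T1)) (of_int k * \<Delta>) \<omega> \<theta>))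
                \<le> ennreal (C (T2 - T1)) *
                    (1 + (SUP k\<in>{k::int. T1 - \<tau> \<le> of_int k * \<Delta> \<and> of_int k * \<Delta> \<le> T1}.
                            if k \<le> 0 then moment M \<tau> p \<xi>
                            else moment M \<tau> p (segment \<tau> (X \<Delta> 0 \<xi>) (of_int k * \<Delta>)))) *
                    ennreal (\<Delta> powr q)"
  shows "\<forall>\<xi> \<in> F 0 \<rightarrow>\<^sub>M Cborel \<tau>. (\<exists>B. AE \<omega> in M. Cnorm \<tau> (\<xi> \<omega>) \<le> B) \<longrightarrow>
           (\<exists>\<Delta>s>0. \<exists>\<K>>0. \<forall>\<Delta>\<in>step_sizes \<tau>. \<Delta> < \<Delta>s \<longrightarrow>
              (SUP k::nat. moment M \<tau> p (\<lambda>\<omega> \<theta>. segment \<tau> (x 0 \<xi>) (real k * \<Delta>) \<omega> \<theta>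
                                              - segment \<tau> (X \<Delta> 0 \<xi>) (real k * \<Delta>) \<omega> \<theta>))
                \<le> ennreal (\<K> * \<Delta> powr q))"
proof (intro ballI impI)
  fix \<xi> :: "'w \<Rightarrow> real \<Rightarrow> real ^ 'd"
  assume \<xi>: "\<xi> \<in> F 0 \<rightarrow>\<^sub>M Cborel \<tau>" and bd: "\<exists>B. AE \<omega> in M. Cnorm \<tau> (\<xi> \<omega>) \<le> B"
  interpret prob_space M by (rule prob)
  note subM = usual_filtration_subalgebra[OF filt]
  have \<tau>0: "0 \<le> \<tau>" using tau by simp
  define a :: real where "a = 2 powr p"
  have a: "0 < a" by (simp add: a_def)
  have \<xi>M: "\<xi> \<in> M \<rightarrow>\<^sub>M Cborel \<tau>" by (rule measurable_from_subalg[OF subM \<xi>]) simp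
  \<comment> \<open>Boundedness of \<open>\<xi>\<close> enters here, as a finite start for the
    moment recursion.\<close>
  obtain b0 where b0: "0 \<le> b0" "moment M \<tau> p \<xi> \<le> ennreal b0"
  proof -
    obtain B where "AE \<omega> in M. Cnorm \<tau> (\<xi> \<omega>) \<le> B" using bd by blast
    then have "AE \<omega> in M. ennreal (Cnorm \<tau> (\<xi> \<omega>) powr p) \<le> ennreal (max B 0 powr p)"
      using AE_space
    proof eventually_elim
      case (elim \<omega>)
      then have "continuous_on {-\<tau>..0} (\<xi> \<omega>)"
        using measurable_space[OF \<xi>M] by (auto simp: space_Cborel mspace_Cspace)
      then have "0 \<le> Cnorm \<tau> (\<xi> \<omega>)" by (rule Cnorm_nonneg[OF \<tau>0])
      then show ?case using elim p by (intro ennreal_leI powr_mono2) auto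
    qed
    then have "moment M \<tau> p \<xi> \<le> (\<integral>\<^sup>+\<omega>. ennreal (max B 0 powr p) \<partial>M)"
      unfolding moment_def by (rule nn_integral_mono_AE)
    also have "\<dots> = ennreal (max B 0 powr p)" by (simp add: emeasure_space_1)
    finally show thesis by (rule that[rotated]) simp
  qed
  \<comment> \<open>Only one quarter: the moment recursion receives a second quarter from (iv),
    through the choice of \<open>\<Delta>s\<close>.\<close>
  obtain n0 where n0: "\<And>n. n0 \<le> n \<Longrightarrow> a * K1 * exp (- (K2 * \<tau> * real n)) \<le> 1 / 4"
    using exp_neg_le_eventually[of "a * K1" "1 / 4" "K2 * \<tau>"] a K123 tau by auto
  obtain n1 where n1: "\<And>n. n1 \<le> n \<Longrightarrow> a * K4 * exp (- (K5 * \<tau> * real n)) \<le> 1 / 2"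
    using exp_neg_le_eventually[of "a * K4" "1 / 2" "K5 * \<tau>"] a K45 tau by auto
  \<comment> \<open>\<open>T\<close> is a multiple of \<open>\<tau>\<close>, hence a grid time for every step size.\<close>
  define N where "N = n0 + n1 + 2"
  define T where "T = real N * \<tau>"
  \<comment> \<open>Since \<open>T\<close> exceeds \<open>\<tau>\<close>, the window before the end
    of block \<open>j\<close> starts strictly after \<open>real j * T\<close>. All its grid times
    are positive, and the convention for nonpositive times matters only for the window before time
    zero.\<close>
  have T: "2 * \<tau> \<le> T" "0 < T"
  proof -
    show "2 * \<tau> \<le> T" unfolding T_def using tau by (intro mult_right_mono) (auto simp: N_def)
    then show "0 < T" using tau by linarith
  qed
  \<comment> \<open>A window may begin only \<open>T - \<tau>\<close> after the restart, so the
    decay in (ii) is evaluated there; the summand \<open>2\<close> in \<open>N\<close> leaves room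
    for this.\<close>
  have "T - \<tau> = \<tau> * real (n0 + n1 + 1)" by (simp add: T_def N_def algebra_simps)
  then have small1: "a * K1 * exp (- K2 * (T - \<tau>)) \<le> 1 / 4"
    using n0[of "n0 + n1 + 1"] by (simp add: mult.assoc)
  have small2: "a * K4 * exp (- K5 * T) \<le> 1 / 2"
    using n1[of N] by (simp add: T_def N_def mult_ac)
  define CT where "CT = C T"
  have CT: "0 < CT" using C_pos T(2) by (simp add: CT_def)
  \<comment> \<open>Solves \<open>a * CT * \<Delta>s powr q = 1 / 4\<close>.\<close>
  define \<Delta>s where "\<Delta>s = (1 / (4 * a * CT)) powr (1 / q)"
  \<comment> \<open>\<open>R\<close> is the bound of \<open>ennreal_half_recursion\<close> for the
    windowed moments, with constant term \<open>a * K3 + 1 / 4\<close>. \<open>L\<close> is the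
    error created in one block per unit of \<open>\<Delta> powr q\<close>. In \<open>\<K>\<close>
    the error \<open>2 * L\<close> at the last block end, amplified by at most
    \<open>a * K4\<close>, is added to the error \<open>L\<close> of the current block.\<close>
  define R where "R = b0 + 2 * (a * K3 + 1 / 4)"
  define L where "L = a * CT * (1 + R)"
  define \<K> where "\<K> = a * K4 * (2 * L) + L"
  have R: "0 < R" using b0 a K123 by (simp add: R_def add_nonneg_pos)
  have L: "0 < L" using a CT R by (simp add: L_def)
  have \<K>: "0 < \<K>" using a K45 L by (simp add: \<K>_def add_pos_pos)
  have "\<forall>\<Delta>\<in>step_sizes \<tau>. \<Delta> < \<Delta>s \<longrightarrow>
      (SUP k::nat. moment M \<tau> p (\<lambda>\<omega> \<theta>. segment \<tau> (x 0 \<xi>) (real k * \<Delta>) \<omega> \<theta>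
                                      - segment \<tau> (X \<Delta> 0 \<xi>) (real k * \<Delta>) \<omega> \<theta>))
        \<le> ennreal (\<K> * \<Delta> powr q)"
  proof (intro ballI impI)
    fix \<Delta> assume \<Delta>: "\<Delta> \<in> step_sizes \<tau>" and small: "\<Delta> < \<Delta>s"
    obtain m :: nat where m: "\<Delta> = \<tau> / real m" "0 < m" using \<Delta> by (auto simp: step_sizes_def)
    have \<Delta>0: "0 < \<Delta>" using m tau by simp
    define D where "D = \<Delta> powr q"
    have D: "0 < D" using \<Delta>0 by (simp add: D_def)
    have "D \<le> \<Delta>s powr q" unfolding D_def using \<Delta>0 small q by (intro powr_mono2) auto
    also have "\<dots> = 1 / (4 * a * CT)" using q a CT by (simp add: \<Delta>s_def powr_powr)
    finally have "a * CT * D \<le> a * CT * (1 / (4 * a * CT))"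
      using a CT by (intro mult_left_mono) auto
    then have small3: "a * (CT * D) \<le> 1 / 4" using a CT by (simp add: field_simps)
    define n where "n = N * m"
    have Tn: "T = real n * \<Delta>" using m by (simp add: T_def n_def)
    have n: "0 < n" using m by (simp add: n_def N_def)
    have num: "numerical_solution M F \<tau> \<Delta> (X \<Delta>)" using i \<Delta> by blast
    define S where "S j = segment \<tau> (X \<Delta> 0 \<xi>) (real j * T)" for j :: nat
    have grid: "of_int k * \<Delta> \<in> grid_times \<Delta>" for k :: int by (auto simp: grid_times_def)
    have gridT: "real j * T \<in> grid_times \<Delta>" for j :: nat
      using grid[of "int (j * n)"] by (simp add: Tn mult.assoc)
    have T_nonneg: "0 \<le> real j * T" for j :: nat using T by simp
    have seg_x: "segment \<tau> (x s \<eta>) t \<in> F t \<rightarrow>\<^sub>M Cborel \<tau>" "segment \<tau> (x s \<eta>) t \<in> M \<rightarrow>\<^sub>M Cborel \<tau>"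
      if "0 \<le> s" "s \<le> t" "\<eta> \<in> F s \<rightarrow>\<^sub>M Cborel \<tau>" for s t \<eta>
    proof -
      have "sdde_solution M F W \<tau> f g s \<eta> (x s \<eta>)"
        using sol that unfolding sdde_unique_solution_def by blast
      from segment_solution_measurable[OF filt tau that this]
      show "segment \<tau> (x s \<eta>) t \<in> F t \<rightarrow>\<^sub>M Cborel \<tau>" .
      then show "segment \<tau> (x s \<eta>) t \<in> M \<rightarrow>\<^sub>M Cborel \<tau>"
        by (rule measurable_from_subalg[OF subM, rotated]) (use that in auto)
    qed
    have seg_X: "segment \<tau> (X \<Delta> s \<eta>) t \<in> F t \<rightarrow>\<^sub>M Cborel \<tau>" "segment \<tau> (X \<Delta> s \<eta>) t \<in> M \<rightarrow>\<^sub>M Cborel \<tau>"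
      if "0 \<le> s" "s \<le> t" "s \<in> grid_times \<Delta>" "t \<in> grid_times \<Delta>" "\<eta> \<in> F s \<rightarrow>\<^sub>M Cborel \<tau>" for s t \<eta>
    proof -
      show "segment \<tau> (X \<Delta> s \<eta>) t \<in> F t \<rightarrow>\<^sub>M Cborel \<tau>"
        using num that unfolding numerical_solution_def by blast
      then show "segment \<tau> (X \<Delta> s \<eta>) t \<in> M \<rightarrow>\<^sub>M Cborel \<tau>"
        by (rule measurable_from_subalg[OF subM, rotated]) (use that in auto)
    qed
    have grid0: "0 \<in> grid_times \<Delta>" using grid[of 0] by simp
    have S: "S j \<in> F (real j * T) \<rightarrow>\<^sub>M Cborel \<tau>" for j
      unfolding S_def by (rule seg_X(1)[OF _ T_nonneg grid0 gridT \<xi>]) simp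
    have S0: "\<forall>\<omega>\<in>space M. \<forall>\<theta>\<in>{-\<tau>..0}. S 0 \<omega> \<theta> = \<xi> \<omega> \<theta>"
    proof -
      have "\<forall>\<omega>\<in>space M. \<forall>\<theta>\<in>{-\<tau>..0}. X \<Delta> 0 \<xi> (0 + \<theta>) \<omega> = \<xi> \<omega> \<theta>"
        using num grid0 \<xi> unfolding numerical_solution_def by blast
      then show ?thesis by (simp add: S_def segment_def)
    qed
    \<comment> \<open>Mirrors the convention in (iv): nonpositive grid times count as the moment of
      \<open>\<xi>\<close>.\<close>
    define mom where "mom k = (if k \<le> 0 then moment M \<tau> p \<xi>
        else moment M \<tau> p (segment \<tau> (X \<Delta> 0 \<xi>) (of_int k * \<Delta>)))" for k :: int
    \<comment> \<open>The window is the range of the supremum on the right of (iv); moments at the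
      block ends alone would not close the recursion.\<close>
    define mm where "mm j = (SUP k\<in>{k::int. real j * T - \<tau> \<le> of_int k * \<Delta> \<and> of_int k * \<Delta> \<le> real j * T}. mom k)"
      for j :: nat
    have mom_S: "moment M \<tau> p (S j) \<le> mm j" for j
    proof -
      have "moment M \<tau> p (S j) = mom (int (j * n))"
      proof (cases "j = 0")
        case True
        have "moment M \<tau> p (S 0) = moment M \<tau> p \<xi>"
          by (rule moment_cong_AE) (rule AE_I2, use S0 in blast)
        with True show ?thesis by (simp add: mom_def)
      next
        case False
        then have "\<not> int (j * n) \<le> 0" using n by (simp add: mult_le_0_iff)
        then show ?thesis by (simp add: mom_def S_def Tn mult.assoc del: of_nat_mult) (simp add: mult.assoc)
      qed
      also have "\<dots> \<le> mm j"
        unfolding mm_def using \<tau>0 by (intro SUP_upper) (auto simp: Tn)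
      finally show ?thesis .
    qed
    have err: "moment M \<tau> p (\<lambda>\<omega> \<theta>. segment \<tau> (x (real j * T) (S j)) t \<omega> \<theta>
          - segment \<tau> (X \<Delta> (real j * T) (S j)) t \<omega> \<theta>) \<le> ennreal (CT * D) * (1 + mm j)"
      if t: "t = of_int k * \<Delta>" "real j * T \<le> t" "t \<le> real (Suc j) * T" for j t and k :: int
    proof -
      \<comment> \<open>All blocks have length \<open>T\<close>, so the single constant
        \<open>CT\<close> serves for every \<open>j\<close>.\<close>
      have len: "real (Suc j) * T - real j * T = T" by (simp add: algebra_simps)
      have "0 \<le> real j * T \<and> real j * T < real (Suc j) * T" using T_nonneg T by simp
      from iv[rule_format, OF \<Delta> \<xi> gridT gridT this]
      have "(SUP k\<in>{k::int. real j * T \<le> of_int k * \<Delta> \<and> of_int k * \<Delta> \<le> real (Suc j) * T}.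
          moment M \<tau> p (\<lambda>\<omega> \<theta>. segment \<tau> (x (real j * T) (S j)) (of_int k * \<Delta>) \<omega> \<theta>
            - segment \<tau> (X \<Delta> (real j * T) (S j)) (of_int k * \<Delta>) \<omega> \<theta>))
          \<le> ennreal CT * (1 + mm j) * ennreal D"
        unfolding len CT_def D_def mm_def mom_def S_def .
      moreover have "ennreal CT * (1 + mm j) * ennreal D = ennreal (CT * D) * (1 + mm j)"
        using CT D by (simp add: ennreal_mult mult_ac)
      ultimately show ?thesis using t by (auto simp: SUP_le_iff)
    qed
    have X_flow: "AE \<omega> in M. \<forall>t\<ge>real j * T. segment \<tau> (X \<Delta> 0 \<xi>) t \<omega> = segment \<tau> (X \<Delta> (real j * T) (S j)) t \<omega>" for j
      unfolding S_def by (rule numerical_flow[OF num \<xi> gridT T_nonneg])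
    have mm_step: "mm (Suc j) \<le> ennreal (1/2) * mm j + ennreal (a * K3 + 1 / 4)" for j
      unfolding mm_def[of "Suc j"]
    proof (rule SUP_least)
      let ?s = "real j * T"
      fix k :: int assume k: "k \<in> {k. real (Suc j) * T - \<tau> \<le> of_int k * \<Delta> \<and> of_int k * \<Delta> \<le> real (Suc j) * T}"
      define t where "t = of_int k * \<Delta>"
      have t: "?s \<le> t" "T - \<tau> \<le> t - ?s" "t \<le> real (Suc j) * T" "0 < t"
      proof -
        have "real (Suc j) * T = ?s + T" by (simp add: algebra_simps)
        moreover have "real (Suc j) * T - \<tau> \<le> t" "t \<le> real (Suc j) * T" using k by (auto simp: t_def)
        ultimately show "?s \<le> t" "T - \<tau> \<le> t - ?s" "t \<le> real (Suc j) * T" "0 < t"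
          using T T_nonneg[of j] tau by linarith+
      qed
      have "0 < k" using t(4) \<Delta>0 by (simp add: t_def zero_less_mult_iff)
      then have "mom k = moment M \<tau> p (segment \<tau> (X \<Delta> 0 \<xi>) t)" by (simp add: mom_def t_def)
      also have "\<dots> = moment M \<tau> p (segment \<tau> (X \<Delta> ?s (S j)) t)"
        by (rule moment_cong_AE) (use X_flow[of j] in eventually_elim, use t in auto)
      also have "\<dots> \<le> ennreal a * (moment M \<tau> p (segment \<tau> (x ?s (S j)) t)
          + moment M \<tau> p (\<lambda>\<omega> \<theta>. segment \<tau> (x ?s (S j)) t \<omega> \<theta> - segment \<tau> (X \<Delta> ?s (S j)) t \<omega> \<theta>))"
        unfolding a_def using grid[of k] gridT[of j] t T_nonneg[of j] S[of j] unfolding t_def[symmetric]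
        by (intro moment_le_add_diff \<tau>0 p seg_x seg_X) auto
      also have "\<dots> \<le> ennreal a * (ennreal (K1 * exp (- K2 * (T - \<tau>))) * mm j + ennreal K3
          + ennreal (CT * D) * (1 + mm j))"
      proof (intro mult_left_mono add_mono err[OF t_def t(1,3)])
        have "moment M \<tau> p (segment \<tau> (x ?s (S j)) (?s + (t - ?s)))
            \<le> ennreal K1 * moment M \<tau> p (S j) * ennreal (exp (- K2 * (t - ?s))) + ennreal K3"
          by (rule ii[rule_format, OF T_nonneg S]) (use t in simp)
        also have "\<dots> \<le> ennreal K1 * mm j * ennreal (exp (- K2 * (T - \<tau>))) + ennreal K3"
          using t(2) K123 by (intro add_mono mult_mono mom_S ennreal_leI) auto
        also have "ennreal K1 * mm j * ennreal (exp (- K2 * (T - \<tau>)))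
            = ennreal (K1 * exp (- K2 * (T - \<tau>))) * mm j"
          using K123 by (simp add: ennreal_mult mult_ac)
        finally show "moment M \<tau> p (segment \<tau> (x ?s (S j)) t)
            \<le> ennreal (K1 * exp (- K2 * (T - \<tau>))) * mm j + ennreal K3" by simp
      qed simp
      \<comment> \<open>Decay and discretisation contribute at most one quarter each to the factor
        of \<open>mm j\<close>; the discretisation also adds at most a quarter to the constant
        term.\<close>
      also have "\<dots> = ennreal (a * (K1 * exp (- K2 * (T - \<tau>))) + a * (CT * D)) * mm j + ennreal (a * K3 + a * (CT * D))"
        using a K123 CT D by (intro ennreal_combine) auto
      also have "\<dots> \<le> ennreal (1/2) * mm j + ennreal (a * K3 + 1 / 4)"
        using small1 small3 K123 by (intro add_mono mult_right_mono ennreal_leI) (auto simp: mult.assoc)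
      finally show "mom k \<le> ennreal (1/2) * mm j + ennreal (a * K3 + 1 / 4)" .
    qed
    \<comment> \<open>The window before time zero holds only nonpositive grid times, where the
      convention gives the moment of \<open>\<xi>\<close>.\<close>
    have mm0: "mm 0 \<le> ennreal b0"
      unfolding mm_def
    proof (rule SUP_least)
      fix k :: int assume "k \<in> {k. real 0 * T - \<tau> \<le> of_int k * \<Delta> \<and> of_int k * \<Delta> \<le> real 0 * T}"
      then have "k \<le> 0" using \<Delta>0 by (simp add: mult_le_0_iff)
      then show "mom k \<le> ennreal b0" using b0 by (simp add: mom_def)
    qed
    have mm: "mm j \<le> ennreal R" for j
      unfolding R_def by (rule ennreal_half_recursion[OF b0(1) _ mm0 mm_step]) (use a K123 in simp)
    define e where "e t = moment M \<tau> p (\<lambda>\<omega> \<theta>. segment \<tau> (x 0 \<xi>) t \<omega> \<theta> - segment \<tau> (X \<Delta> 0 \<xi>) t \<omega> \<theta>)" for t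
    \<comment> \<open>The data are arbitrary here, since this is applied to the exact and the
      numerical segment at a block end.\<close>
    have contr: "moment M \<tau> p (\<lambda>\<omega> \<theta>. segment \<tau> (x s \<zeta>) t \<omega> \<theta> - segment \<tau> (x s \<eta>) t \<omega> \<theta>)
        \<le> ennreal (K4 * exp (- K5 * (t - s))) * moment M \<tau> p (\<lambda>\<omega> \<theta>. \<zeta> \<omega> \<theta> - \<eta> \<omega> \<theta>)"
      if s: "0 \<le> s" "s \<le> t" and data: "\<zeta> \<in> F s \<rightarrow>\<^sub>M Cborel \<tau>" "\<eta> \<in> F s \<rightarrow>\<^sub>M Cborel \<tau>" for s t \<zeta> \<eta>
    proof (rule sdde_contraction_extends[OF prob filt tau sol p s _ data])
      fix K and \<zeta> \<eta> :: "'w \<Rightarrow> real \<Rightarrow> real ^ 'd"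
      assume *: "compactin (mtopology_of (Cspace \<tau>)) K" "\<zeta> \<in> F s \<rightarrow>\<^sub>M Cborel \<tau>" "\<eta> \<in> F s \<rightarrow>\<^sub>M Cborel \<tau>"
        "\<forall>\<omega>\<in>space M. \<zeta> \<omega> \<in> K \<and> \<eta> \<omega> \<in> K"
      have "moment M \<tau> p (\<lambda>\<omega> \<theta>. segment \<tau> (x s \<zeta>) (s + (t - s)) \<omega> \<theta> - segment \<tau> (x s \<eta>) (s + (t - s)) \<omega> \<theta>)
          \<le> ennreal K4 * moment M \<tau> p (\<lambda>\<omega> \<theta>. \<zeta> \<omega> \<theta> - \<eta> \<omega> \<theta>) * ennreal (exp (- K5 * (t - s)))"
        by (rule iii[rule_format, OF *(1) s(1) *(2,3)]) (use * s in auto)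
      then show "moment M \<tau> p (\<lambda>\<omega> \<theta>. segment \<tau> (x s \<zeta>) t \<omega> \<theta> - segment \<tau> (x s \<eta>) t \<omega> \<theta>)
          \<le> ennreal (K4 * exp (- K5 * (t - s))) * moment M \<tau> p (\<lambda>\<omega> \<theta>. \<zeta> \<omega> \<theta> - \<eta> \<omega> \<theta>)"
        using K45 by (simp add: ennreal_mult mult_ac)
    qed
    have e_step: "e t \<le> ennreal (a * K4 * exp (- K5 * (t - real j * T))) * e (real j * T) + ennreal (L * D)"
      if t: "t = of_int k * \<Delta>" "real j * T \<le> t" "t \<le> real (Suc j) * T" for j t and k :: int
    proof -
      let ?s = "real j * T"
      let ?Sx = "segment \<tau> (x 0 \<xi>) ?s"
      have Sx: "?Sx \<in> F ?s \<rightarrow>\<^sub>M Cborel \<tau>" by (rule seg_x(1)[OF _ T_nonneg \<xi>]) simp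
      have "AE \<omega> in M. \<forall>t\<ge>?s. segment \<tau> (x 0 \<xi>) t \<omega> = segment \<tau> (x ?s ?Sx) t \<omega>"
        by (rule sdde_flow[OF filt tau sol _ T_nonneg \<xi>]) simp
      then have "e t = moment M \<tau> p (\<lambda>\<omega> \<theta>. segment \<tau> (x ?s ?Sx) t \<omega> \<theta> - segment \<tau> (X \<Delta> ?s (S j)) t \<omega> \<theta>)"
        unfolding e_def using X_flow[of j]
        by (intro moment_cong_AE, eventually_elim) (use t in auto)
      \<comment> \<open>The intermediate process is the exact solution restarted from
        \<open>S j\<close>: it differs from the true solution only in its data, which is controlled
        by \<open>contr\<close>, and from the numerical one only by discretisation, which is
        controlled by \<open>err\<close>.\<close>
      also have "\<dots> \<le> ennreal a *
          (moment M \<tau> p (\<lambda>\<omega> \<theta>. segment \<tau> (x ?s ?Sx) t \<omega> \<theta> - segment \<tau> (x ?s (S j)) t \<omega> \<theta>)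
           + moment M \<tau> p (\<lambda>\<omega> \<theta>. segment \<tau> (x ?s (S j)) t \<omega> \<theta> - segment \<tau> (X \<Delta> ?s (S j)) t \<omega> \<theta>))"
        unfolding a_def using grid[of k] gridT[of j] t T_nonneg[of j] S[of j] Sx \<xi>
        by (intro moment_diff_triangle \<tau>0 p seg_x seg_X) auto
      also have "\<dots> \<le> ennreal a * (ennreal (K4 * exp (- K5 * (t - ?s))) * e ?s + ennreal (CT * D) * (1 + ennreal R))"
      proof (intro mult_left_mono add_mono)
        show "moment M \<tau> p (\<lambda>\<omega> \<theta>. segment \<tau> (x ?s ?Sx) t \<omega> \<theta> - segment \<tau> (x ?s (S j)) t \<omega> \<theta>)
            \<le> ennreal (K4 * exp (- K5 * (t - ?s))) * e ?s"
          unfolding e_def using contr[OF T_nonneg t(2) Sx S] unfolding S_def .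
        show "moment M \<tau> p (\<lambda>\<omega> \<theta>. segment \<tau> (x ?s (S j)) t \<omega> \<theta> - segment \<tau> (X \<Delta> ?s (S j)) t \<omega> \<theta>)
            \<le> ennreal (CT * D) * (1 + ennreal R)"
          using mm[of j] by (intro order_trans[OF err[OF t]] mult_left_mono add_left_mono) auto
      qed simp
      also have "ennreal (CT * D) * (1 + ennreal R) = ennreal (CT * D * (1 + R))"
        using CT D R by (simp add: ennreal_mult flip: ennreal_1 ennreal_plus)
      also have "ennreal a * (ennreal (K4 * exp (- K5 * (t - ?s))) * e ?s + ennreal (CT * D * (1 + R)))
          = ennreal (a * K4 * exp (- K5 * (t - ?s))) * e ?s + ennreal (L * D)"
        using a K45 CT D R by (simp add: L_def ennreal_mult distrib_left mult_ac)
      finally show ?thesis .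
    qed
    have e_block: "e (real j * T) \<le> ennreal (0 + 2 * (L * D))" for j
    proof (rule ennreal_half_recursion)
      have "\<forall>\<omega>\<in>space M. \<forall>\<theta>\<in>{-\<tau>..0}. x 0 \<xi> (0 + \<theta>) \<omega> = \<xi> \<omega> \<theta>"
        using sol \<xi> unfolding sdde_unique_solution_def sdde_solution_def by blast
      then have "AE \<omega> in M. \<forall>\<theta>\<in>{-\<tau>..0}. segment \<tau> (x 0 \<xi>) 0 \<omega> \<theta> - S 0 \<omega> \<theta> = 0"
        using S0 by (intro AE_I2) (simp add: segment_def)
      then have "moment M \<tau> p (\<lambda>\<omega> \<theta>. segment \<tau> (x 0 \<xi>) 0 \<omega> \<theta> - S 0 \<omega> \<theta>) = 0"
        by (rule moment_eq_0[OF \<tau>0 p])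
      then show "e (real 0 * T) \<le> ennreal 0" by (simp add: e_def S_def)
      show "e (real (Suc j) * T) \<le> ennreal (1/2) * e (real j * T) + ennreal (L * D)" for j
      proof -
        have "e (real (Suc j) * T) \<le> ennreal (a * K4 * exp (- K5 * (real (Suc j) * T - real j * T))) * e (real j * T)
            + ennreal (L * D)"
          using T by (intro e_step[of _ "int (Suc j * n)"]) (auto simp: Tn algebra_simps)
        also have "real (Suc j) * T - real j * T = T" by (simp add: algebra_simps)
        also have "ennreal (a * K4 * exp (- K5 * T)) * e (real j * T) + ennreal (L * D)
            \<le> ennreal (1/2) * e (real j * T) + ennreal (L * D)"
          using small2 L D by (intro add_mono mult_right_mono ennreal_leI) auto
        finally show ?thesis .
      qed
    qed (use L D in auto)
    have "e (real k * \<Delta>) \<le> ennreal (\<K> * D)" for k :: nat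
    proof -
      \<comment> \<open>A general grid time is reached from the last block end by one use of
        \<open>e_step\<close>, with the exponential factor bounded by \<open>1\<close>.\<close>
      define j where "j = k div n"
      have j: "j * n \<le> k" "k \<le> Suc j * n"
        using n by (auto simp: j_def dividend_less_div_times less_imp_le)
      have t: "real j * T \<le> real k * \<Delta>" "real k * \<Delta> \<le> real (Suc j) * T"
      proof -
        have "real (j * n) * \<Delta> \<le> real k * \<Delta>" "real k * \<Delta> \<le> real (Suc j * n) * \<Delta>"
          using j \<Delta>0 by (intro mult_right_mono; simp only: of_nat_le_iff less_imp_le)+
        then show "real j * T \<le> real k * \<Delta>" "real k * \<Delta> \<le> real (Suc j) * T"
          by (simp_all only: Tn of_nat_mult mult.assoc)
      qed
      have "e (real k * \<Delta>) \<le> ennreal (a * K4 * exp (- K5 * (real k * \<Delta> - real j * T))) * e (real j * T) + ennreal (L * D)"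
        using t by (intro e_step[of _ "int k"]) auto
      also have "\<dots> \<le> ennreal (a * K4) * ennreal (2 * (L * D)) + ennreal (L * D)"
      proof (rule add_mono[OF mult_mono[OF ennreal_leI] order_refl])
        have "exp (- K5 * (real k * \<Delta> - real j * T)) \<le> 1" using t K45 by simp
        then show "a * K4 * exp (- K5 * (real k * \<Delta> - real j * T)) \<le> a * K4"
          using a K45 by (intro mult_left_le) auto
        show "e (real j * T) \<le> ennreal (2 * (L * D))" using e_block[of j] by simp
      qed auto
      also have "\<dots> = ennreal (\<K> * D)"
        using a K45 L D by (simp add: \<K>_def algebra_simps flip: ennreal_mult ennreal_plus)
      finally show ?thesis .
    qed
    then show "(SUP k::nat. moment M \<tau> p (\<lambda>\<omega> \<theta>. segment \<tau> (x 0 \<xi>) (real k * \<Delta>) \<omega> \<theta>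
        - segment \<tau> (X \<Delta> 0 \<xi>) (real k * \<Delta>) \<omega> \<theta>)) \<le> ennreal (\<K> * \<Delta> powr q)"
      unfolding e_def D_def by (intro SUP_least)
  qed
  moreover have "0 < \<Delta>s" using a CT by (simp add: \<Delta>s_def)
  ultimately show "\<exists>\<Delta>s>0. \<exists>\<K>>0. \<forall>\<Delta>\<in>step_sizes \<tau>. \<Delta> < \<Delta>s \<longrightarrow>
      (SUP k::nat. moment M \<tau> p (\<lambda>\<omega> \<theta>. segment \<tau> (x 0 \<xi>) (real k * \<Delta>) \<omega> \<theta>
                                      - segment \<tau> (X \<Delta> 0 \<xi>) (real k * \<Delta>) \<omega> \<theta>))
        \<le> ennreal (\<K> * \<Delta> powr q)"
    using \<K> by blast
qed

end
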